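(* Let $w,u\in\mathbb{N}$, $v\in\mathbb{Z}$, let $M,D,\lambda$ be constants, and let $\boldsymbol\alpha,\boldsymbol\beta,\boldsymbol\delta,\boldsymbol\gamma$ be complex parameter vectors such that $$ F\left(\begin{matrix}\boldsymbol\alpha\\\boldsymbol\beta\end{matrix}\,\Big|\,Mx^{w}\right)=(1-x)^{\lambda}F\left(\begin{matrix}\boldsymbol\delta\\\boldsymbol\gamma\end{matrix}\,\Big|\,\frac{Dx^{u}}{(1-x)^v}\right) $$ holds for $x\in(0,1)$. Let $\mathbf{a},\mathbf{b}\in\mathbb{C}^p$, $p\in\mathbb{N}$. Suppose further that either (i) $\boldsymbol\delta$ or $\mathbf{a}$ contains a negative integer, or (ii) $v=0$, $D=1$ and $$ \Re(\mathbf{a})>0\ \text{(element-wise)},\qquad \Re(s(\mathbf{a},\mathbf{b})+\lambda)>0,\qquad \Re(s(\mathbf{a},\mathbf{b})+s(\boldsymbol\delta,\boldsymbol\gamma)+\lambda)>0 . $$ Then, provided the hypergeometric series involved converge (or terminate), $$ F\left(\begin{matrix}\boldsymbol\alpha,\Delta(\mathbf{a},w)\\\boldsymbol\beta,\Delta(\mathbf{b},w)\end{matrix}\,\Big|\,M\right) =\sum_{k=0}^{\infty}\frac{(\boldsymbol\delta)_k(\mathbf{a})_{uk}D^k}{(\boldsymbol\gamma)_k(\mathbf{b})_{uk}k!}\, F\left(\begin{matrix}-\lambda+vk,\;\mathbf{a}+uk\\\mathbf{b}+uk\end{matrix}\,\Big|\,1\right), $$ where terms with $(\boldsymbol\delta)_k(\mathbf{a})_{uk}=0$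 are understood to be zero.
   Context: $(a)_n=\Gamma(a+n)/\Gamma(a)$; for vectors $(\mathbf{a})_n=\prod_j(a_j)_n$, and $\mathbf{a}+\beta$ means adding $\beta$ to each component. $F\left(\begin{smallmatrix}\mathbf{a}\\\mathbf{b}\end{smallmatrix}\big|x\right)=\sum_{n\ge0}\frac{(\mathbf{a})_n}{(\mathbf{b})_n n!}x^n$ is the generalized hypergeometric function. $\Delta(a,w)=\left(\frac aw,\frac{a+1}w,\dots,\frac{a+w-1}w\right)$, applied component-wise to vectors (concatenating the results). $s(\mathbf{a},\mathbf{b})$ is the sum of the components of $\mathbf{b}$ minus the sum of the components of $\mathbf{a}$ (parametric excess). Lower parameters of hypergeometric functions are assumed never to be non-positive integers. *)

theory Defs
  imports "HOL-Complex_Analysis.Complex_Analysis"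
begin

definition vpoch :: "complex list \<Rightarrow> nat \<Rightarrow> complex" where
  "vpoch a n = (\<Prod>z\<leftarrow>a. pochhammer z n)"

definition vshift :: "complex list \<Rightarrow> complex \<Rightarrow> complex list" where
  "vshift a c = map (\<lambda>z. z + c) a"

definition Delta :: "complex list \<Rightarrow> nat \<Rightarrow> complex list" where
  "Delta a w = concat (map (\<lambda>z. map (\<lambda>i. (z + of_nat i) / of_nat w) [0..<w]) a)"

definition excess :: "complex list \<Rightarrow> complex list \<Rightarrow> complex" where
  "excess a b = sum_list b - sum_list a"

definition hyp_term :: "complex list \<Rightarrow> complex list \<Rightarrow> complex \<Rightarrow> nat \<Rightarrow> complex" where
  "hyp_term a b z n = vpoch a n / (vpoch b n * fact n) * z ^ n"

definition hyp_converges :: "complex list \<Rightarrow> complex list \<Rightarrow> complex \<Rightarrow> bool" where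
  "hyp_converges a b z \<longleftrightarrow> summable (hyp_term a b z)"

text \<open>
  The function F is the sum of its series wherever the series converges. If there is one
  more upper than lower parameter and the series does not terminate, its radius of
  convergence is 1, and elsewhere F is the principal branch, holomorphic off the cut
  from 1 to infinity. For instance Pfaff's transformation, whose right-hand argument is
  -x/(1-x), holds on all of (0,1) only in this sense. No continuation exists when the
  series has radius of convergence 0, and F is then defined only where the series
  converges.
\<close>

definition cut_plane :: "complex set" where
  "cut_plane = - {z. Im z = 0 \<and> Re z \<ge> 1}"

definition hyp_continuation ::
    "complex list \<Rightarrow> complex list \<Rightarrow> (complex \<Rightarrow> complex) \<Rightarrow> bool" where
  "hyp_continuation a b f \<longleftrightarrow>
     f holomorphic_on cut_plane \<and> (\<forall>z\<in>ball 0 1. hyp_term a b z sums f z)"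

definition hyp_defined :: "complex list \<Rightarrow> complex list \<Rightarrow> complex \<Rightarrow> bool" where
  "hyp_defined a b z \<longleftrightarrow>
     hyp_converges a b z \<or> (z \<in> cut_plane \<and> (\<exists>f. hyp_continuation a b f))"

definition hyp_F :: "complex list \<Rightarrow> complex list \<Rightarrow> complex \<Rightarrow> complex" where
  "hyp_F a b z =
     (if hyp_converges a b z then (\<Sum>n. hyp_term a b z n)
      else (SOME f. hyp_continuation a b f) z)"

lemma hyp_continuation_unique:
  assumes f: "hyp_continuation a b f" and g: "hyp_continuation a b g" and z: "z \<in> cut_plane"
  shows "f z = g z"
proof -
  have "closed ({z. Im z = 0} \<inter> {z. Re z \<ge> 1})"
    by (intro closed_Int closed_halfspace_Re_ge closed_Collect_eq continuous_intros)
  moreover have "cut_plane = - ({z. Im z = 0} \<inter> {z. Re z \<ge> 1})"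
    by (auto simp: cut_plane_def)
  ultimately have op: "open cut_plane"
    by (metis open_Compl)
  have "starlike cut_plane"
    unfolding starlike_def
  proof (intro bexI[of _ 0] ballI subsetI)
    fix p q assume p: "p \<in> cut_plane" and "q \<in> closed_segment 0 p"
    then obtain u where u: "0 \<le> u" "u \<le> 1" "q = u *\<^sub>R p"
      by (auto simp: closed_segment_def)
    have "Re p \<ge> 1 \<and> Im p = 0" if "u * Im p = 0" "u * Re p \<ge> 1"
    proof -
      have "u \<noteq> 0" using that by auto
      then have "u > 0" using u by simp
      then have "Re p > 0" using that by (smt (verit) mult_nonneg_nonpos)
      then have "u * Re p \<le> Re p" using u by (simp add: mult_left_le_one_le)
      then show ?thesis using that \<open>u \<noteq> 0\<close> by auto
    qed
    with p u show "q \<in> cut_plane"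
      by (auto simp: cut_plane_def)
  qed (auto simp: cut_plane_def)
  then have conn: "connected cut_plane"
    by (rule starlike_imp_connected)
  have sub: "ball 0 1 \<subseteq> cut_plane"
  proof
    fix y :: complex assume "y \<in> ball 0 1"
    then have "Re y < 1" using complex_Re_le_cmod[of y] by simp
    then show "y \<in> cut_plane" by (simp add: cut_plane_def)
  qed
  have "f y = g y" if "y \<in> ball 0 1" for y
    using f g that sums_unique2 unfolding hyp_continuation_def by blast
  then show ?thesis
    using analytic_continuation_open[of "ball 0 1" cut_plane f g z] f g op conn sub z
    by (simp add: hyp_continuation_def)
qed

end

theory Submission
  imports Defs "HOL-Real_Asymp.Real_Asymp"
begin

text \<open>
  Comparing the power series coefficients of the hypothesis at 0 gives
  \<open>c m = (\<Sum>k | u * k \<le> m. q k * e k (m - u * k))\<close>, where \<open>c\<close> is supported on the multiples of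
  \<open>w\<close>, \<open>q k\<close> are the terms of \<open>F(delta; gamma | D)\<close> and \<open>e k\<close> the coefficients of
  \<open>(1 - x) powr (lam - v * k)\<close>. Multiplying by \<open>A m = (a)\<^sub>m / (b)\<^sub>m\<close> and summing over \<open>m\<close> first or
  over \<open>k\<close> first yields the two sides. In case (i) only finitely many \<open>k\<close> contribute.

  In case (ii) the double series need not converge absolutely when \<open>Re lam > 0\<close>. It does so after
  inserting \<open>x ^ m\<close> with \<open>0 < x < 1\<close>, and one lets \<open>x\<close> tend to 1: the \<open>m\<close>-series by Abel's limit
  theorem, the \<open>k\<close>-series by Tannery's theorem. The dominating bound needs the cancellation in
  \<open>\<Sum>j. e j * A (n + j) * x ^ (n + j)\<close>, which is a fractional difference of order \<open>lam\<close> of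
  \<open>A m * x ^ m\<close>. Since \<open>l\<close>-fold differences of \<open>A m * x ^ m\<close> are \<open>O(m powr (Re (\<Sum>a - \<Sum>b) - l))\<close>
  uniformly in \<open>x\<close>, that sum is \<open>O(n powr (Re (\<Sum>a - \<Sum>b) - Re lam + eps))\<close>, and the two inequalities
  on the parametric excesses make the resulting bound summable over \<open>k\<close>.
\<close>

subsection \<open>Growth of Pochhammer quotients and their differences\<close>

text \<open>Comparability in both directions makes one estimate cover exponents of either sign. It
  lets the index in a power bound be replaced by a shifted one.\<close>

lemma powr_comparable:
  fixes x y c e :: real
  assumes "x > 0" "y > 0" "x \<le> c * y" "y \<le> c * x"
  shows "x powr e \<le> c powr \<bar>e\<bar> * y powr e"
proof -
  have c: "c > 0" using assms by (metis less_le_trans zero_less_mult_pos2)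
  have "x powr e = (x / y) powr e * y powr e"
    using assms by (simp add: powr_divide)
  moreover have "(x / y) powr e \<le> c powr \<bar>e\<bar>"
  proof (cases "e \<ge> 0")
    case True
    then show ?thesis using assms by (auto intro!: powr_mono2 simp: field_simps)
  next
    case False
    have "(x / y) powr e = (y / x) powr (- e)"
      using assms by (simp add: powr_divide powr_minus field_simps)
    also have "\<dots> \<le> c powr (- e)"
      using assms False by (intro powr_mono2) (auto simp: field_simps)
    finally show ?thesis using False by simp
  qed
  ultimately show ?thesis by (simp add: mult_right_mono)
qed

lemma pochhammer_nonpos_Int_nonzero:
  fixes b :: complex
  assumes "b \<notin> \<int>\<^sub>\<le>\<^sub>0"
  shows "pochhammer b n \<noteq> 0"
  using assms by (auto simp: pochhammer_eq_0_iff)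

lemma plus_of_nat_notin_nonpos_Ints:
  fixes b :: complex
  assumes "b \<notin> \<int>\<^sub>\<le>\<^sub>0"
  shows "b + of_nat n \<notin> \<int>\<^sub>\<le>\<^sub>0"
  using nonpos_Ints_diff_Nats[of "b + of_nat n" "of_nat n"] assms by auto

text \<open>The quotient of the two \<open>rGamma_series\<close> converges because
  \<open>rGamma b\<close> is nonzero, hence it is bounded. Up to a power of the index it is the
  Pochhammer quotient. The parameter \<open>a\<close> may be a nonpositive integer.\<close>

lemma pochhammer_ratio_bound:
  fixes a b :: complex
  assumes b: "b \<notin> \<int>\<^sub>\<le>\<^sub>0"
  shows "\<exists>C. \<forall>m. norm (pochhammer a m / pochhammer b m) \<le> C * real (Suc m) powr Re (a - b)"
proof -
  define e where "e = Re (a - b)"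
  define h where "h = (\<lambda>m. norm (pochhammer a m / pochhammer b m) / real (Suc m) powr e)"
  have "(\<lambda>n. rGamma_series a n / rGamma_series b n) \<longlonglongrightarrow> rGamma a / rGamma b"
    using b by (intro tendsto_intros) (simp add: rGamma_eq_zero_iff)
  then have "Bseq (\<lambda>n. rGamma_series a n / rGamma_series b n)"
    by (intro convergent_imp_Bseq convergentI)
  then obtain K where K: "\<And>n. norm (rGamma_series a n / rGamma_series b n) \<le> K"
    unfolding Bseq_def by blast
  \<comment> \<open>\<open>rGamma_series\<close> at \<open>Suc n\<close> contains the Pochhammer
    symbol of index \<open>n + 2\<close> and \<open>ln (Suc n)\<close>, so starting at 2 avoids the
    logarithm of 0. The 3 comes from \<open>n + 3 <= 3 * (n + 1)\<close>.\<close>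
  have "norm (h (n + 2)) \<le> K * 3 powr \<bar>e\<bar>" for n
  proof -
    have exp: "norm (exp ((a - b) * of_real (ln (of_nat (Suc n))))) = real (Suc n) powr e"
      by (simp add: e_def powr_def norm_exp_eq_Re mult.commute del: of_nat_Suc)
    have "pochhammer a (n + 2) / pochhammer b (n + 2) =
        rGamma_series a (Suc n) / rGamma_series b (Suc n) * exp ((a - b) * of_real (ln (of_nat (Suc n))))"
      by (simp add: rGamma_series_def ring_distribs exp_diff field_simps del: of_nat_Suc)
    then have "norm (pochhammer a (n + 2) / pochhammer b (n + 2)) \<le> K * real (Suc n) powr e"
      using K[of "Suc n"] by (simp only: norm_mult exp) (intro mult_right_mono, auto)
    also have "\<dots> \<le> K * (3 powr \<bar>e\<bar> * real (Suc (n + 2)) powr e)"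
      using order_trans[OF norm_ge_zero K[of 0]]
      by (intro mult_left_mono powr_comparable) auto
    finally show ?thesis
      by (simp add: h_def divide_simps mult_ac del: of_nat_Suc)
  qed
  then have "Bseq (\<lambda>n. h (n + 2))"
    by (intro BseqI')
  then have "Bseq h"
    by (rule Bseq_offset)
  then obtain C where "\<And>m. norm (h m) \<le> C"
    unfolding Bseq_def by blast
  then have "norm (pochhammer a m / pochhammer b m) \<le> C * real (Suc m) powr e" for m
    by (simp add: h_def divide_simps del: of_nat_Suc)
  then show ?thesis unfolding e_def by blast
qed

lemma pochhammer_ratio_bound_list:
  assumes "length a = length b" "set b \<inter> \<int>\<^sub>\<le>\<^sub>0 = {}"
  shows "\<exists>C. \<forall>m. norm (vpoch a m / vpoch b m) \<le> C * real (Suc m) powr Re (sum_list a - sum_list b)"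
  using assms
proof (induction a b rule: list_induct2)
  case Nil
  then show ?case by (auto simp: vpoch_def intro!: exI[of _ 1])
next
  case (Cons x xs y ys)
  obtain C where C: "\<And>m. norm (vpoch xs m / vpoch ys m) \<le> C * real (Suc m) powr Re (sum_list xs - sum_list ys)"
    using Cons by auto
  obtain D where D: "\<And>m. norm (pochhammer x m / pochhammer y m) \<le> D * real (Suc m) powr Re (x - y)"
    using Cons pochhammer_ratio_bound[of y x] by auto
  show ?case
  proof (intro exI[of _ "D * C"] allI)
    fix m
    have "norm (vpoch (x # xs) m / vpoch (y # ys) m) =
        norm (pochhammer x m / pochhammer y m) * norm (vpoch xs m / vpoch ys m)"
      by (simp add: vpoch_def norm_mult norm_divide)
    also have "\<dots> \<le> (D * real (Suc m) powr Re (x - y)) * (C * real (Suc m) powr Re (sum_list xs - sum_list ys))"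
      by (intro mult_mono C D order_trans[OF norm_ge_zero D]) auto
    also have "\<dots> = D * C * real (Suc m) powr Re (sum_list (x # xs) - sum_list (y # ys))"
      by (simp add: powr_add [symmetric] algebra_simps del: of_nat_Suc)
    finally show "norm (vpoch (x # xs) m / vpoch (y # ys) m) \<le>
        D * C * real (Suc m) powr Re (sum_list (x # xs) - sum_list (y # ys))" .
  qed
qed

section \<open>Finite differences and discrete symbol classes\<close>

definition fdiff :: "(nat \<Rightarrow> complex) \<Rightarrow> nat \<Rightarrow> complex" where
  "fdiff f m = f m - f (Suc m)"

text \<open>Discrete analogue of the symbol classes of pseudodifferential calculus, uniformly in the index.\<close>
definition symbol_class :: "'i set \<Rightarrow> real \<Rightarrow> ('i \<Rightarrow> nat \<Rightarrow> complex) \<Rightarrow> bool" where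
  "symbol_class I r F \<longleftrightarrow>
     (\<forall>l. \<exists>C\<ge>0. \<forall>i\<in>I. \<forall>m. norm ((fdiff ^^ l) (F i) m) \<le> C * real (Suc m) powr (r - real l))"

lemma fdiff_funpow_add: "(fdiff ^^ l) (\<lambda>m. f m + g m) m = (fdiff ^^ l) f m + (fdiff ^^ l) g m"
  by (induction l arbitrary: m) (simp_all add: fdiff_def)

lemma fdiff_funpow_shift: "(fdiff ^^ l) (\<lambda>m. f (m + n)) m = (fdiff ^^ l) f (m + n)"
  by (induction l arbitrary: m) (simp_all add: fdiff_def)

lemma fdiff_mult: "fdiff (\<lambda>m. f m * g m) = (\<lambda>m. fdiff f m * g m + f (m + 1) * fdiff g m)"
  by (auto simp: fdiff_def algebra_simps)

lemma symbol_class_fdiff: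
  assumes "symbol_class I r F"
  shows "symbol_class I (r - 1) (\<lambda>i. fdiff (F i))"
  unfolding symbol_class_def
proof
  fix l
  obtain C where "C \<ge> 0" "\<forall>i\<in>I. \<forall>m. norm ((fdiff ^^ Suc l) (F i) m) \<le> C * real (Suc m) powr (r - real (Suc l))"
    using assms unfolding symbol_class_def by blast
  then show "\<exists>C\<ge>0. \<forall>i\<in>I. \<forall>m. norm ((fdiff ^^ l) (fdiff (F i)) m) \<le> C * real (Suc m) powr (r - 1 - real l)"
    by (intro exI[of _ C]) (simp add: funpow_swap1 algebra_simps)
qed

text \<open>The discrete Leibniz rule evaluates one factor at \<open>m + 1\<close>; since
  \<open>m + 2 <= 2 * (m + 1)\<close>, this only changes the constants.\<close>

lemma symbol_class_shift:
  assumes "symbol_class I r F"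
  shows "symbol_class I r (\<lambda>i m. F i (m + 1))"
  unfolding symbol_class_def
proof
  fix l
  define e where "e = r - real l"
  obtain C where C: "C \<ge> 0" "\<forall>i\<in>I. \<forall>m. norm ((fdiff ^^ l) (F i) m) \<le> C * real (Suc m) powr e"
    using assms unfolding symbol_class_def e_def by blast
  have "norm ((fdiff ^^ l) (\<lambda>m. F i (m + 1)) m) \<le> C * 2 powr \<bar>e\<bar> * real (Suc m) powr e" if "i \<in> I" for i m
  proof -
    have "norm ((fdiff ^^ l) (\<lambda>m. F i (m + 1)) m) \<le> C * real (Suc (m + 1)) powr e"
      using C that by (simp only: fdiff_funpow_shift)
    also have "\<dots> \<le> C * (2 powr \<bar>e\<bar> * real (Suc m) powr e)"
      using C by (intro mult_left_mono powr_comparable) auto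
    finally show ?thesis by (simp add: mult_ac)
  qed
  then show "\<exists>C\<ge>0. \<forall>i\<in>I. \<forall>m. norm ((fdiff ^^ l) (\<lambda>m. F i (m + 1)) m) \<le> C * real (Suc m) powr (r - real l)"
    using C(1) unfolding e_def by (intro exI[of _ "C * 2 powr \<bar>r - real l\<bar>"]) auto
qed

text \<open>Induction on the number of differences. By \<open>fdiff_mult\<close>, one difference
  splits the product into two products, each with orders adding up to \<open>r + s - 1\<close>;
  hence the orders and the families are generalised in the induction.\<close>

lemma symbol_class_mult:
  assumes "symbol_class I r F" "symbol_class I s G"
  shows "symbol_class I (r + s) (\<lambda>i m. F i m * G i m)"
proof -
  have "\<exists>C\<ge>0. \<forall>i\<in>I. \<forall>m. norm ((fdiff ^^ l) (\<lambda>m. F i m * G i m) m) \<le> C * real (Suc m) powr (r + s - real l)" for l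
    using assms
  proof (induction l arbitrary: r s F G)
    case 0
    obtain C where C: "C \<ge> 0" "\<forall>i\<in>I. \<forall>m. norm ((fdiff ^^ 0) (F i) m) \<le> C * real (Suc m) powr (r - real 0)"
      using 0 unfolding symbol_class_def by blast
    obtain D where D: "D \<ge> 0" "\<forall>i\<in>I. \<forall>m. norm ((fdiff ^^ 0) (G i) m) \<le> D * real (Suc m) powr (s - real 0)"
      using 0 unfolding symbol_class_def by blast
    have "norm (F i m * G i m) \<le> C * D * real (Suc m) powr (r + s)" if "i \<in> I" for i m
    proof -
      have "norm (F i m * G i m) \<le> (C * real (Suc m) powr r) * (D * real (Suc m) powr s)"
        unfolding norm_mult using C D that by (intro mult_mono) auto
      then show ?thesis by (simp add: powr_add mult_ac)
    qed
    then show ?case using C(1) D(1) by (intro exI[of _ "C * D"]) auto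
  next
    case (Suc l)
    obtain C where C: "C \<ge> 0" "\<forall>i\<in>I. \<forall>m. norm ((fdiff ^^ l) (\<lambda>m. fdiff (F i) m * G i m) m)
        \<le> C * real (Suc m) powr (r - 1 + s - real l)"
      using Suc.IH[OF symbol_class_fdiff[OF Suc.prems(1)] Suc.prems(2)] by blast
    obtain D where D: "D \<ge> 0" "\<forall>i\<in>I. \<forall>m. norm ((fdiff ^^ l) (\<lambda>m. F i (m + 1) * fdiff (G i) m) m)
        \<le> D * real (Suc m) powr (r + (s - 1) - real l)"
      using Suc.IH[OF symbol_class_shift[OF Suc.prems(1)] symbol_class_fdiff[OF Suc.prems(2)]] by blast
    have "norm ((fdiff ^^ Suc l) (\<lambda>m. F i m * G i m) m) \<le> (C + D) * real (Suc m) powr (r + s - real (Suc l))"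
      if "i \<in> I" for i m
    proof -
      have "(fdiff ^^ Suc l) (\<lambda>m. F i m * G i m) m =
          (fdiff ^^ l) (\<lambda>m. fdiff (F i) m * G i m) m + (fdiff ^^ l) (\<lambda>m. F i (m + 1) * fdiff (G i) m) m"
        by (simp only: funpow_Suc_right o_def fdiff_mult fdiff_funpow_add)
      also have "norm \<dots> \<le> C * real (Suc m) powr (r - 1 + s - real l) + D * real (Suc m) powr (r + (s - 1) - real l)"
        using C D that by (intro order_trans[OF norm_triangle_ineq] add_mono) auto
      also have "\<dots> = (C + D) * real (Suc m) powr (r + s - real (Suc l))"
        by (simp add: algebra_simps)
      finally show ?thesis .
    qed
    then show ?case using C(1) D(1) by (intro exI[of _ "C + D"]) auto
  qed
  then show ?thesis unfolding symbol_class_def by blast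
qed

text \<open>One difference raises the lower parameter by 1 and multiplies by
  \<open>(b - a) / b\<close>. The shape is preserved, so iteration gives a closed form in which each
  difference gains one power of decay in \<open>m\<close>.\<close>

lemma fdiff_funpow_pochhammer_ratio:
  fixes a b :: complex
  assumes "b \<notin> \<int>\<^sub>\<le>\<^sub>0"
  shows "(fdiff ^^ l) (\<lambda>m. pochhammer a m / pochhammer b m) m =
    pochhammer (b - a) l / pochhammer b l * (pochhammer a m / pochhammer (b + of_nat l) m)"
proof (induction l arbitrary: m)
  case (Suc l)
  define c where "c = b + of_nat l"
  have c: "c \<notin> \<int>\<^sub>\<le>\<^sub>0" using assms plus_of_nat_notin_nonpos_Ints c_def by blast
  have nz: "pochhammer c k \<noteq> 0" "pochhammer (c + 1) k \<noteq> 0" "c \<noteq> 0" "c + of_nat k \<noteq> 0" "pochhammer b k \<noteq> 0" for k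
    using c assms plus_of_nat_notin_nonpos_Ints[of c 1] plus_of_nat_notin_nonpos_Ints[of c k]
    by (auto intro!: pochhammer_nonpos_Int_nonzero)
  have eq: "pochhammer c m * (c + of_nat m) = c * pochhammer (c + 1) m"
    using pochhammer_rec[of c m] pochhammer_Suc[of c m] by simp
  have "pochhammer a m / pochhammer c m - pochhammer a (Suc m) / pochhammer c (Suc m)
      = pochhammer a m * (c - a) / (pochhammer c m * (c + of_nat m))"
  proof -
    have "x / p - x * (a + k) / (p * (c + k)) = x * (c - a) / (p * (c + k))"
      if "p \<noteq> 0" "c + k \<noteq> 0" for x p k :: complex
      using that by (simp add: divide_simps) (simp add: algebra_simps)
    from this[OF nz(1) nz(4)] show ?thesis
      by (simp only: pochhammer_Suc)
  qed
  also have "\<dots> = (c - a) / c * (pochhammer a m / pochhammer (c + 1) m)"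
    unfolding eq using nz by (simp add: field_simps)
  finally have main: "pochhammer a m / pochhammer c m - pochhammer a (Suc m) / pochhammer c (Suc m)
      = (c - a) / c * (pochhammer a m / pochhammer (c + 1) m)" .
  have "(fdiff ^^ Suc l) (\<lambda>m. pochhammer a m / pochhammer b m) m
     = pochhammer (b - a) l / pochhammer b l *
       (pochhammer a m / pochhammer c m - pochhammer a (Suc m) / pochhammer c (Suc m))"
    by (simp add: Suc.IH fdiff_def c_def right_diff_distrib)
  also have "\<dots> = pochhammer (b - a) (Suc l) / pochhammer b (Suc l) * (pochhammer a m / pochhammer (c + 1) m)"
  proof -
    have "b - a + of_nat l = c - a" "b + of_nat l = c" by (simp_all add: c_def)
    then show ?thesis unfolding main unfolding pochhammer_Suc by (simp only: times_divide_times_eq mult_ac)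
  qed
  finally show ?case by (simp add: c_def add_ac)
qed auto

lemma symbol_class_pochhammer_ratio:
  fixes a b :: complex
  assumes "b \<notin> \<int>\<^sub>\<le>\<^sub>0"
  shows "symbol_class I (Re (a - b)) (\<lambda>i m. pochhammer a m / pochhammer b m)"
  unfolding symbol_class_def
proof
  fix l
  obtain C where C: "\<And>m. norm (pochhammer a m / pochhammer (b + of_nat l) m) \<le>
      C * real (Suc m) powr Re (a - (b + of_nat l))"
    using pochhammer_ratio_bound[OF plus_of_nat_notin_nonpos_Ints[OF assms]] by blast
  have C0: "C \<ge> 0" using order_trans[OF norm_ge_zero C[of 0]] by simp
  define K where "K = norm (pochhammer (b - a) l / pochhammer b l)"
  have "norm ((fdiff ^^ l) (\<lambda>m. pochhammer a m / pochhammer b m) m) \<le>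
      K * (C * real (Suc m) powr Re (a - (b + of_nat l)))" for m
    unfolding fdiff_funpow_pochhammer_ratio[OF assms] norm_mult K_def
    by (intro mult_left_mono C norm_ge_zero)
  then show "\<exists>C\<ge>0. \<forall>i\<in>I. \<forall>m. norm ((fdiff ^^ l) (\<lambda>m. pochhammer a m / pochhammer b m) m)
      \<le> C * real (Suc m) powr (Re (a - b) - real l)"
    using C0 by (intro exI[of _ "K * C"]) (auto simp: K_def algebra_simps)
qed

lemma fdiff_funpow_power: "(fdiff ^^ l) (\<lambda>m. z ^ m) m = (1 - z) ^ l * z ^ m"
  by (induction l arbitrary: m) (simp_all add: fdiff_def algebra_simps)

text \<open>Uniformity in \<open>x\<close> up to 1 is the point: the \<open>l\<close>-fold
  difference is \<open>(1 - x) ^ l * x ^ m\<close>, and its first factor is small where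
  \<open>x ^ m\<close> decays slowly.\<close>

lemma symbol_class_power: "symbol_class {0..1} 0 (\<lambda>(x::real) m. of_real x ^ m)"
  unfolding symbol_class_def
proof
  fix l
  have "norm ((fdiff ^^ l) (\<lambda>m. of_real x ^ m) m) \<le> real l ^ l * real (Suc m) powr (0 - real l)"
    if x: "x \<in> {0..1}" for x m
  proof (cases "l = 0")
    case True
    then show ?thesis using x by (simp add: norm_power power_le_one)
  next
    case False
    \<comment> \<open>As \<open>l * q <= m\<close>, the power \<open>x ^ m\<close> supplies a factor
      \<open>x ^ q\<close> for each of the \<open>l\<close> factors \<open>1 - x\<close>, and
      \<open>(1 - x) * x ^ q\<close> is at most \<open>1 / (q + 1)\<close> by the finite geometric
      sum.\<close>
    define q where "q = m div l"
    have "real (Suc q) * x ^ q \<le> (\<Sum>i\<le>q. x ^ i)"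
    proof -
      have "(\<Sum>i\<le>q. x ^ q) \<le> (\<Sum>i\<le>q. x ^ i)"
        using x by (intro sum_mono power_decreasing) auto
      then show ?thesis by simp
    qed
    then have "(1 - x) * (real (Suc q) * x ^ q) \<le> (1 - x) * (\<Sum>i\<le>q. x ^ i)"
      using x by (intro mult_left_mono) auto
    also have "\<dots> = 1 - x ^ Suc q"
      using sum_gp_basic[of x q] by simp
    also have "\<dots> \<le> 1" using x by simp
    finally have 1: "(1 - x) * x ^ q \<le> 1 / real (Suc q)"
      by (simp add: field_simps)
    have "Suc m \<le> l * Suc q"
      using False dividend_less_times_div[of l m] by (simp add: q_def)
    then have "real (Suc m) \<le> real l * real (Suc q)"
      by (metis of_nat_le_iff of_nat_mult)
    then have 2: "1 / real (Suc q) \<le> real l / real (Suc m)"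
      by (simp add: field_simps)
    have "norm (1 - of_real x :: complex) = 1 - x"
      using x norm_of_real[of "1 - x", where ?'a = complex] by simp
    then have "norm ((fdiff ^^ l) (\<lambda>m. of_real x ^ m) m) = (1 - x) ^ l * x ^ m"
      using x by (simp add: fdiff_funpow_power norm_mult norm_power)
    also have "\<dots> \<le> (1 - x) ^ l * x ^ (q * l)"
      using x by (intro mult_left_mono power_decreasing) (auto simp: q_def)
    also have "\<dots> = ((1 - x) * x ^ q) ^ l"
      by (simp add: power_mult power_mult_distrib)
    also have "\<dots> \<le> (real l / real (Suc m)) ^ l"
      using x 1 2 by (intro power_mono) auto
    also have "\<dots> = real l ^ l * real (Suc m) powr (0 - real l)"
      by (simp add: power_divide powr_minus powr_realpow field_simps)
    finally show ?thesis .
  qed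
  then show "\<exists>C\<ge>0. \<forall>x\<in>{0..1}. \<forall>m. norm ((fdiff ^^ l) (\<lambda>m. of_real x ^ m) m) \<le> C * real (Suc m) powr (0 - real l)"
    by (intro exI[of _ "real l ^ l"]) auto
qed

lemma symbol_class_vpoch_ratio_power:
  assumes "length a = length b" "set b \<inter> \<int>\<^sub>\<le>\<^sub>0 = {}"
  shows "symbol_class {0..1} (Re (sum_list a - sum_list b))
    (\<lambda>(x::real) m. vpoch a m / vpoch b m * of_real x ^ m)"
  using assms
proof (induction a b rule: list_induct2)
  case Nil
  then show ?case using symbol_class_power by (simp add: vpoch_def)
next
  case (Cons x xs y ys)
  have "symbol_class {0..1} (Re (x - y) + Re (sum_list xs - sum_list ys))
     (\<lambda>(t::real) m. pochhammer x m / pochhammer y m * (vpoch xs m / vpoch ys m * of_real t ^ m))"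
    using Cons by (intro symbol_class_mult symbol_class_pochhammer_ratio) auto
  then show ?case by (simp add: vpoch_def algebra_simps)
qed

subsection \<open>Comparison of coefficients\<close>

lemma hyp_term_mult: "hyp_term a b (c * y) = (\<lambda>n. hyp_term a b c n * y ^ n)"
  by (auto simp: hyp_term_def power_mult_distrib)

text \<open>The factor \<open>c\<close> is kept in the coefficients. Either the series converges at
  the nonzero point \<open>y\<close> itself, or a continuation exists and its series converges for
  all arguments in the unit disc.\<close>

lemma hyp_term_radius_pos:
  assumes "hyp_defined a b (c * y)" "y \<noteq> 0"
  shows "fps_conv_radius (Abs_fps (hyp_term a b c)) > 0"
proof -
  have *: ?thesis if "hyp_converges a b (c * x)" "x \<noteq> 0" for x
  proof -
    have "conv_radius (hyp_term a b c) \<ge> norm x"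
      using that by (intro conv_radius_geI) (simp add: hyp_converges_def hyp_term_mult)
    then show ?thesis using that
      by (simp add: fps_conv_radius_def) (metis ereal_less(2) less_le_trans zero_less_norm_iff)
  qed
  show ?thesis
  proof (cases "hyp_converges a b (c * y)")
    case True
    then show ?thesis using * assms by blast
  next
    case False
    then obtain f where f: "hyp_continuation a b f"
      using assms by (auto simp: hyp_defined_def)
    \<comment> \<open>The added 1 covers \<open>c = 0\<close> and makes
      \<open>norm c * r < 1\<close>.\<close>
    define r where "r = 1 / (norm c + 1)"
    define x :: complex where "x = of_real r"
    have pos: "norm c + 1 > 0" by (smt (verit) norm_ge_zero)
    then have r: "r > 0" "norm c * r < 1" by (simp_all add: r_def field_simps)
    then have "norm (c * x) < 1" by (simp add: x_def norm_mult)
    then have "hyp_converges a b (c * x)"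
      using f by (auto simp: hyp_continuation_def hyp_converges_def sums_iff)
    moreover have "x \<noteq> 0" using r by (simp add: x_def)
    ultimately show ?thesis using * by blast
  qed
qed

lemma hyp_F_eq_eval_fps:
  assumes "norm y < fps_conv_radius (Abs_fps (hyp_term a b c))"
  shows "hyp_F a b (c * y) = eval_fps (Abs_fps (hyp_term a b c)) y"
  using summable_fps[OF assms]
  by (simp add: hyp_F_def hyp_converges_def hyp_term_mult eval_fps_def)

section \<open>Binomial series and formal power series at 0\<close>

definition fps_one_minus_powr :: "complex \<Rightarrow> complex fps" where
  "fps_one_minus_powr c = Abs_fps (\<lambda>j. pochhammer (- c) j / fact j)"

lemma fps_one_minus_powr_altdef: "fps_one_minus_powr c = fps_binomial c oo (fps_const (-1) * fps_X)"
proof -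
  have "(-1) ^ n * (c gchoose n) = pochhammer (- c) n / fact n" for n
    by (simp add: gbinomial_pochhammer flip: power_mult_distrib)
  then show ?thesis
    by (simp only: fps_compose_linear fps_one_minus_powr_def fps_binomial_nth)
qed

lemma fps_one_minus_powr_add:
  "fps_one_minus_powr (c + d) = fps_one_minus_powr c * fps_one_minus_powr d"
  unfolding fps_one_minus_powr_altdef fps_binomial_add_mult
  by (rule fps_compose_mult_distrib) simp

lemma fps_one_minus_powr_power: "fps_one_minus_powr c ^ n = fps_one_minus_powr (of_nat n * c)"
proof (induction n)
  case 0
  show ?case by (simp add: fps_one_minus_powr_altdef)
qed (simp add: fps_one_minus_powr_add ring_distribs)

lemma has_fps_expansion_one_minus_powr:
  "(\<lambda>x. (1 - x) powr c) has_fps_expansion fps_one_minus_powr c"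
proof -
  have "(\<lambda>x::complex. -1 * x) has_fps_expansion (fps_const (-1) * fps_X)"
    by (intro fps_expansion_intros)
  then have "((\<lambda>x. (1 + x) powr c) \<circ> (\<lambda>x. -1 * x)) has_fps_expansion fps_one_minus_powr c"
    unfolding fps_one_minus_powr_altdef by (intro has_fps_expansion_compose fps_expansion_intros) auto
  then show ?thesis by (simp add: o_def)
qed

text \<open>A nonzero analytic germ has no zeros in a punctured neighbourhood of 0, so agreement on
  a one-sided real interval already forces equal series. Real points of \<open>(0,1)\<close> are all
  that the hypothesis of the theorem provides.\<close>

lemma fps_expansion_unique_at_right:
  fixes f g :: "complex \<Rightarrow> complex"
  assumes F: "f has_fps_expansion F" and G: "g has_fps_expansion G"
    and eq: "eventually (\<lambda>x::real. f (of_real x) = g (of_real x)) (at_right 0)"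
  shows "F = G"
proof (rule ccontr)
  assume "F \<noteq> G"
  have "(\<lambda>x. f x - g x) has_fps_expansion F - G"
    by (intro fps_expansion_intros F G)
  then have "(\<lambda>x. f x - g x) has_laurent_expansion fps_to_fls (F - G)"
    by (rule has_laurent_expansion_fps)
  then have "eventually (\<lambda>x. f x - g x \<noteq> 0) (at 0)"
    using \<open>F \<noteq> G\<close> by (subst has_laurent_expansion_eventually_nonzero_iff) auto
  moreover have "filterlim (of_real :: real \<Rightarrow> complex) (at 0) (at_right 0)"
    by (auto simp: filterlim_at eventually_at_filter intro!: tendsto_eq_intros)
  ultimately have "eventually (\<lambda>x::real. f (of_real x) - g (of_real x) \<noteq> 0) (at_right 0)"
    by (rule eventually_compose_filterlim)
  with eq have "eventually (\<lambda>x::real. False) (at_right 0)"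
    by eventually_elim simp
  then show False by simp
qed

lemma fps_compose_X_power_nth:
  assumes "w \<ge> 1"
  shows "fps_nth (F oo fps_X ^ w) m = (if w dvd m then fps_nth F (m div w) else (0 :: complex))"
proof -
  have "fps_nth (F oo fps_X ^ w) m = (\<Sum>i\<in>{0..m}. if m = w * i then fps_nth F i else 0)"
    by (auto simp: fps_compose_nth fps_X_power_nth simp flip: power_mult intro!: sum.cong)
  also have "\<dots> = (if w dvd m then fps_nth F (m div w) else 0)"
  proof (cases "w dvd m")
    case True
    then have "(\<Sum>i\<in>{0..m}. if m = w * i then fps_nth F i else 0) = (\<Sum>i\<in>{0..m}. if i = m div w then fps_nth F i else 0)"
      using assms by (intro sum.cong) auto
    then show ?thesis using True by simp
  qed (auto intro!: sum.neutral)
  finally show ?thesis .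
qed

text \<open>Exponents of \<open>1 - x\<close> add, so the \<open>k\<close>-th power of the inner
  series, times the prefactor, is \<open>fps_X ^ (u * k)\<close> times a single binomial series.
  Each \<open>k\<close> thus contributes one coefficient.\<close>

lemma fps_mult_compose_one_minus_powr_nth:
  assumes "u \<ge> 1"
  shows "fps_nth (fps_one_minus_powr c * (F oo (fps_X ^ u * fps_one_minus_powr d))) m =
    (\<Sum>k | u * k \<le> m. fps_nth F k * (pochhammer (- c - of_nat k * d) (m - u * k) / fact (m - u * k)))"
proof -
  define B where "B = fps_X ^ u * fps_one_minus_powr d"
  have Bk: "B ^ k = fps_X ^ (u * k) * fps_one_minus_powr (of_nat k * d)" for k
    by (simp add: B_def power_mult_distrib fps_one_minus_powr_power power_mult)
  have cB: "fps_one_minus_powr c * B ^ k = fps_X ^ (u * k) * fps_one_minus_powr (c + of_nat k * d)" for k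
    by (simp add: Bk fps_one_minus_powr_add mult_ac)
  have coeff: "fps_nth (fps_one_minus_powr c * B ^ k) m =
      (if m < u * k then 0 else pochhammer (- c - of_nat k * d) (m - u * k) / fact (m - u * k))" for k
    by (simp only: cB fps_X_power_mult_nth) (simp add: fps_one_minus_powr_def diff_diff_eq)
  have le: "k \<le> u * k" for k using assms by simp
  \<comment> \<open>\<open>B ^ k\<close> starts in degree \<open>u * k >= k\<close>, so the sum may
    run up to \<open>m\<close> independently of \<open>j\<close>; this allows the exchange of the
    two sums.\<close>
  have compose: "fps_nth (F oo B) j = (\<Sum>k\<in>{0..m}. fps_nth F k * fps_nth (B ^ k) j)" if "j \<le> m" for j
  proof -
    have "fps_nth (B ^ k) j = 0" if "j < k" for k
    proof -
      have "j < u * k" using le[of k] that by linarith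
      then show ?thesis by (simp add: Bk fps_X_power_mult_nth)
    qed
    then show ?thesis
      unfolding fps_compose_nth using that by (intro sum.mono_neutral_left) auto
  qed
  have "fps_nth (fps_one_minus_powr c * (F oo B)) m =
      (\<Sum>i=0..m. fps_nth (fps_one_minus_powr c) i * (\<Sum>k\<in>{0..m}. fps_nth F k * fps_nth (B ^ k) (m - i)))"
    unfolding fps_mult_nth by (intro sum.cong refl) (subst compose, auto)
  also have "\<dots> = (\<Sum>k\<in>{0..m}. fps_nth F k * fps_nth (fps_one_minus_powr c * B ^ k) m)"
    unfolding fps_mult_nth sum_distrib_left by (subst sum.swap) (simp add: mult_ac)
  also have "\<dots> = (\<Sum>k | u * k \<le> m. fps_nth F k * (pochhammer (- c - of_nat k * d) (m - u * k) / fact (m - u * k)))"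
  proof (rule sum.mono_neutral_cong_right)
    have "k \<le> m" if "u * k \<le> m" for k using le[of k] that by linarith
    then show "{k. u * k \<le> m} \<subseteq> {0..m}" by auto
  qed (auto simp: coeff)
  finally show ?thesis unfolding B_def .
qed

text \<open>Both sides of the hypothesis have power series at 0 with positive radius, and these
  agree to the right of 0. The composed series are then equal coefficientwise.\<close>

lemma coefficient_identity:
  fixes w u :: nat and v :: int
  assumes "w \<ge> 1" "u \<ge> 1"
    and hyp: "\<forall>x\<in>{0<..<(1::real)}.
           hyp_defined alpha beta (M * of_real x ^ w) \<and>
           hyp_defined delta gamma (D * of_real x ^ u / of_real (1 - x) powi v) \<and>
           hyp_F alpha beta (M * of_real x ^ w) =
             of_real (1 - x) powr lam *
             hyp_F delta gamma (D * of_real x ^ u / of_real (1 - x) powi v)"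
  shows "(\<Sum>k | u * k \<le> m. hyp_term delta gamma D k *
           (pochhammer (- lam + of_int v * of_nat k) (m - u * k) / fact (m - u * k))) =
         (if w dvd m then hyp_term alpha beta M (m div w) else 0)"
proof -
  define P where "P = Abs_fps (hyp_term alpha beta M)"
  define Q where "Q = Abs_fps (hyp_term delta gamma D)"
  define B where "B = fps_X ^ u * fps_one_minus_powr (- of_int v)"
  \<comment> \<open>\<open>D\<close> goes into the coefficients of \<open>Q\<close> and not into
    \<open>y\<close>, so that \<open>y\<close> is nonzero on \<open>(0,1)\<close> even for
    \<open>D = 0\<close>.\<close>
  define y where "y = (\<lambda>x::complex. x ^ u * (1 - x) powr (- of_int v))"
  have y_eq: "D * of_real x ^ u / of_real (1 - x) powi v = D * y (of_real x)" if "x < 1" for x :: real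
  proof -
    have "(1 :: complex) - of_real x \<noteq> 0" using that by (simp add: complex_eq_iff)
    then show ?thesis by (simp add: y_def powr_minus complex_powr_of_int field_simps)
  qed
  have half: "hyp_defined alpha beta (M * of_real (1/2) ^ w)"
    "hyp_defined delta gamma (D * of_real (1/2) ^ u / of_real (1 - 1/2) powi v)"
    using bspec[OF hyp, of "1/2"] by simp_all
  have P: "fps_conv_radius P > 0"
    unfolding P_def using half by (intro hyp_term_radius_pos[of _ _ _ "of_real (1/2) ^ w"]) auto
  have Q: "fps_conv_radius Q > 0"
    unfolding Q_def using half y_eq[of "1/2"]
    by (intro hyp_term_radius_pos[of _ _ _ "y (of_real (1/2))"]) (auto simp: y_def)
  have B: "y has_fps_expansion B"
    unfolding y_def B_def by (intro fps_expansion_intros has_fps_expansion_one_minus_powr)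
  have B0: "fps_nth B 0 = 0" using assms by (simp add: B_def)
  have X: "(\<lambda>x. x ^ w) has_fps_expansion (fps_X ^ w :: complex fps)"
    by (intro fps_expansion_intros)
  have "(eval_fps P \<circ> (\<lambda>x. x ^ w)) has_fps_expansion (P oo fps_X ^ w)"
    using assms by (intro has_fps_expansion_compose eval_fps_has_fps_expansion P X) auto
  moreover have "(\<lambda>x. (1 - x) powr lam * (eval_fps Q \<circ> y) x) has_fps_expansion
      (fps_one_minus_powr lam * (Q oo B))"
    using B0 by (intro has_fps_expansion_mult has_fps_expansion_one_minus_powr
        has_fps_expansion_compose eval_fps_has_fps_expansion Q B)
  moreover have "eventually (\<lambda>x::real. (eval_fps P \<circ> (\<lambda>x. x ^ w)) (of_real x) =
      (1 - of_real x) powr lam * (eval_fps Q \<circ> y) (of_real x)) (at_right 0)"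
  proof -
    \<comment> \<open>Close to 0 the inner arguments lie in the disc of convergence, where
      \<open>hyp_F\<close> is the sum of its series and the analytic continuation does not
      enter.\<close>
    have small: "eventually (\<lambda>x::real. ereal (norm (f (of_real x))) < R) (at_right 0)"
      if f: "f has_fps_expansion F" "f 0 = 0" and R: "R > 0"
      for f :: "complex \<Rightarrow> complex" and F and R :: ereal
    proof -
      have "continuous (at 0) f"
        by (rule has_fps_expansion_imp_continuous[OF f(1)])
      then have "((\<lambda>x::real. f (of_real x)) \<longlongrightarrow> 0) (at_right 0)"
        using f(2) by (intro isCont_tendsto_compose[of 0 f, THEN tendsto_eq_rhs]) (auto intro!: tendsto_eq_intros)
      then have "((\<lambda>x::real. ereal (norm (f (of_real x)))) \<longlongrightarrow> ereal 0) (at_right 0)"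
        by (intro tendsto_ereal tendsto_norm_zero)
      then show ?thesis by (rule order_tendstoD(2)) (use R in \<open>simp add: zero_ereal_def\<close>)
    qed
    have "eventually (\<lambda>x::real. x \<in> {0<..<1}) (at_right 0)"
      by (rule eventually_at_right_real) simp
    moreover have "eventually (\<lambda>x::real. ereal (norm ((of_real x :: complex) ^ w)) < fps_conv_radius P) (at_right 0)"
      using assms by (intro small[OF X _ P]) auto
    moreover have "eventually (\<lambda>x::real. ereal (norm (y (of_real x))) < fps_conv_radius Q) (at_right 0)"
      using assms by (intro small[OF B _ Q]) (auto simp: y_def)
    ultimately show ?thesis
    proof eventually_elim
      case (elim x)
      then have "hyp_F alpha beta (M * of_real x ^ w) = eval_fps P (of_real x ^ w)"
        "hyp_F delta gamma (D * y (of_real x)) = eval_fps Q (y (of_real x))"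
        unfolding P_def Q_def by (intro hyp_F_eq_eval_fps; simp)+
      with hyp elim y_eq[of x] show ?case by (simp add: o_def)
    qed
  qed
  ultimately have "P oo fps_X ^ w = fps_one_minus_powr lam * (Q oo B)"
    by (rule fps_expansion_unique_at_right)
  then have "fps_nth (fps_one_minus_powr lam * (Q oo B)) m = fps_nth (P oo fps_X ^ w) m"
    by simp
  then show ?thesis
    unfolding B_def fps_mult_compose_one_minus_powr_nth[OF assms(2)] fps_compose_X_power_nth[OF assms(1)]
    by (simp add: P_def Q_def mult.commute)
qed

subsection \<open>Abel summation and fractional differences\<close>

text \<open>Summation by parts with \<open>d m\<close>, the error of the partial sum through index
  \<open>m\<close>, turns the difference from \<open>S\<close> into \<open>(1 - x)\<close> times a
  power series whose coefficients tend to 0.\<close>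

lemma Abel_limit_theorem:
  fixes c :: "nat \<Rightarrow> complex"
  assumes "c sums S"
  shows "((\<lambda>x::real. \<Sum>m. c m * of_real x ^ m) \<longlongrightarrow> S) (at_left 1)"
proof -
  define d where "d = (\<lambda>m. (\<Sum>i<Suc m. c i) - S)"
  have "(\<lambda>m. (\<Sum>i<Suc m. c i) - S) \<longlonglongrightarrow> S - S"
    by (rule tendsto_diff[OF LIMSEQ_Suc[OF assms[unfolded sums_def]] tendsto_const])
  then have d0: "d \<longlonglongrightarrow> 0" unfolding d_def by (simp only: diff_self)
  then obtain K where K: "\<And>m. norm (d m) \<le> K"
    using convergent_imp_Bseq[OF convergentI[OF d0]] unfolding Bseq_def by blast
  have K0: "K \<ge> 0" using order_trans[OF norm_ge_zero K[of 0]] .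
  have summ: "summable (\<lambda>m. norm (d m) * x ^ m)" if "0 \<le> x" "x < 1" for x :: real
  proof (rule summable_comparison_test')
    show "summable (\<lambda>m. K * x ^ m)"
      using that by (intro summable_mult summable_geometric) simp
    show "norm (norm (d m) * x ^ m) \<le> K * x ^ m" if "m \<ge> 0" for m
      using \<open>0 \<le> x\<close> K[of m] by (simp add: abs_mult mult_right_mono)
  qed
  have eq: "(\<Sum>m. c m * of_real x ^ m) - S = of_real (1 - x) * (\<Sum>m. d m * of_real x ^ m)"
    if x: "0 \<le> x" "x < 1" for x :: real
  proof -
    define z :: complex where "z = of_real x"
    define G where "G = (\<Sum>m. d m * z ^ m)"
    have sd: "summable (\<lambda>m. d m * z ^ m)"
      by (rule summable_norm_cancel) (use summ x in \<open>simp add: z_def norm_mult norm_power\<close>)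
    then have G: "(\<lambda>m. d m * z ^ m) sums G" by (simp add: G_def summable_sums)
    then have "(\<lambda>m. d (Suc m) * z ^ Suc m) sums (G - d 0)"
      using sums_Suc_iff[of "\<lambda>m. d m * z ^ m" "G - d 0"] by simp
    from sums_diff[OF this sums_mult[OF G, of z]]
    have "(\<lambda>m. c (Suc m) * z ^ Suc m) sums (G - d 0 - z * G)"
      by (simp add: d_def algebra_simps)
    then have "(\<lambda>m. c m * z ^ m) sums (G - d 0 - z * G + c 0)"
      using sums_Suc_iff[of "\<lambda>m. c m * z ^ m" "G - d 0 - z * G"] by simp
    then show ?thesis by (simp add: sums_iff d_def z_def G_def algebra_simps)
  qed
  have "((\<lambda>x::real. (\<Sum>m. c m * of_real x ^ m) - S) \<longlongrightarrow> 0) (at_left 1)"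
  proof (rule tendstoI)
    fix e :: real assume e: "e > 0"
    obtain N where N: "\<And>m. m \<ge> N \<Longrightarrow> norm (d m) < e / 2"
      using LIMSEQ_D[OF d0, of "e / 2"] e by auto
    \<comment> \<open>The first \<open>N\<close> terms contribute at most
      \<open>(1 - x) * N * K\<close>, which vanishes in the limit. The remaining ones contribute at
      most \<open>e / 2\<close>, since \<open>1 - x\<close> cancels the sum of the geometric
      series.\<close>
    have "((\<lambda>x::real. (1 - x) * (real N * K)) \<longlongrightarrow> (1 - 1) * (real N * K)) (at_left 1)"
      by (intro tendsto_intros)
    then have "eventually (\<lambda>x::real. (1 - x) * (real N * K) < e / 2) (at_left 1)"
      using e by (intro order_tendstoD(2)) auto
    moreover have "eventually (\<lambda>x::real. x \<in> {0<..<1}) (at_left 1)"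
      by (rule eventually_at_left_real) simp
    ultimately show "eventually (\<lambda>x::real. dist ((\<Sum>m. c m * of_real x ^ m) - S) 0 < e) (at_left 1)"
    proof eventually_elim
      case (elim x)
      have x: "0 \<le> x" "x < 1" using elim by auto
      have g: "(\<lambda>m. e / 2 * x ^ m) sums (e / 2 * (1 / (1 - x)))"
        using x by (intro sums_mult geometric_sums) auto
      have f: "(\<lambda>m. if m < N then K else 0) sums (\<Sum>m<N. K)"
        using sums_If_finite_set[of "{..<N}" "\<lambda>_. K"] by simp
      have "norm (\<Sum>m. d m * of_real x ^ m) \<le> (\<Sum>m. norm (d m) * x ^ m)"
        using summable_norm[of "\<lambda>m. d m * of_real x ^ m"] summ x by (simp add: norm_mult norm_power)
      also have "\<dots> \<le> (\<Sum>m. e / 2 * x ^ m + (if m < N then K else 0))"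
      proof (rule suminf_le)
        fix m
        have "norm (d m) * x ^ m \<le> K * 1"
          using x K K0 by (intro mult_mono power_le_one) auto
        moreover have "norm (d m) * x ^ m \<le> e / 2 * x ^ m" if "m \<ge> N"
          using x N[OF that] by (intro mult_right_mono) auto
        moreover have "0 \<le> e / 2 * x ^ m" using e x by simp
        ultimately show "norm (d m) * x ^ m \<le> e / 2 * x ^ m + (if m < N then K else 0)"
          by (cases "m < N") auto
      qed (use summ x sums_summable[OF g] sums_summable[OF f] in \<open>auto intro: summable_add\<close>)
      also have "\<dots> = e / 2 * (1 / (1 - x)) + real N * K"
        using sums_unique[OF sums_add[OF g f]] by simp
      finally have "(1 - x) * norm (\<Sum>m. d m * of_real x ^ m) \<le> (1 - x) * (e / 2 * (1 / (1 - x)) + real N * K)"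
        using x by (intro mult_left_mono) auto
      also have "\<dots> = e / 2 + (1 - x) * (real N * K)"
        using x by (simp add: field_simps)
      also have "\<dots> < e" using elim by simp
      finally show ?case
        using x by (simp only: eq norm_mult dist_norm diff_0_right norm_of_real)
    qed
  qed
  then show ?thesis by (simp add: Lim_null[of _ S])
qed

text \<open>The constants may depend on the sequence: this notion serves only to justify
  rearrangements at a fixed \<open>x < 1\<close>, while uniform estimates come from
  \<open>symbol_class\<close>.\<close>

definition geometric_decay :: "(nat \<Rightarrow> complex) \<Rightarrow> bool" where
  "geometric_decay B \<longleftrightarrow> (\<exists>C r. 0 \<le> r \<and> r < 1 \<and> (\<forall>m. norm (B m) \<le> C * r ^ m))"

lemma polynomial_times_geometric:
  fixes x p :: real
  assumes "0 \<le> x" "x < 1"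
  shows "\<exists>C r. 0 \<le> C \<and> 0 \<le> r \<and> r < 1 \<and> (\<forall>m. real (Suc m) powr p * x ^ m \<le> C * r ^ m)"
proof -
  \<comment> \<open>The geometric factor is split into two equal halves, one absorbing the power of
    \<open>m\<close>, the other giving the decay. The maximum with \<open>1/2\<close> keeps
    \<open>r\<close> positive when \<open>x = 0\<close>.\<close>
  define r where "r = sqrt (max x (1/2))"
  have r: "0 < r" "r < 1" "x \<le> r * r"
    using assms by (auto simp: r_def)
  have "Bseq (\<lambda>m. real (Suc m) powr p * r ^ m)"
  proof (intro convergent_imp_Bseq convergentI)
    show "(\<lambda>m. real (Suc m) powr p * r ^ m) \<longlonglongrightarrow> 0"
      using r(1,2) by real_asymp
  qed
  then obtain K where K: "\<And>m. norm (real (Suc m) powr p * r ^ m) \<le> K"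
    unfolding Bseq_def by blast
  have "real (Suc m) powr p * x ^ m \<le> K * r ^ m" for m
  proof -
    have "real (Suc m) powr p * x ^ m \<le> real (Suc m) powr p * (r * r) ^ m"
      using r assms by (intro mult_left_mono power_mono) auto
    also have "\<dots> = (real (Suc m) powr p * r ^ m) * r ^ m"
      by (simp add: power_mult_distrib)
    also have "\<dots> \<le> K * r ^ m"
      using r K[of m] by (intro mult_right_mono) auto
    finally show ?thesis .
  qed
  moreover have "K \<ge> 0" using order_trans[OF norm_ge_zero K[of 0]] .
  ultimately show ?thesis using r by (intro exI[of _ K] exI[of _ r]) auto
qed

lemma geometric_decay_mult:
  assumes "geometric_decay B" "\<And>m. norm (e m) \<le> C * real (Suc m) powr p"
  shows "geometric_decay (\<lambda>m. e m * B m)"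
proof -
  obtain D r where D: "0 \<le> r" "r < 1" "\<And>m. norm (B m) \<le> D * r ^ m"
    using assms unfolding geometric_decay_def by blast
  obtain K s where K: "0 \<le> K" "0 \<le> s" "s < 1" "\<And>m. real (Suc m) powr p * r ^ m \<le> K * s ^ m"
    using polynomial_times_geometric[OF D(1,2)] by blast
  have C0: "C \<ge> 0" using order_trans[OF norm_ge_zero assms(2)[of 0]] by simp
  have D0: "D \<ge> 0" using order_trans[OF norm_ge_zero D(3)[of 0]] by simp
  have "norm (e m * B m) \<le> (C * D * K) * s ^ m" for m
  proof -
    have "norm (e m * B m) \<le> (C * real (Suc m) powr p) * (D * r ^ m)"
      unfolding norm_mult using C0 by (intro mult_mono assms D) auto
    also have "\<dots> = (C * D) * (real (Suc m) powr p * r ^ m)" by simp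
    also have "\<dots> \<le> (C * D) * (K * s ^ m)"
      using C0 D0 by (intro mult_left_mono K) auto
    finally show ?thesis by (simp add: mult_ac)
  qed
  then show ?thesis unfolding geometric_decay_def using K by blast
qed

lemma geometric_decay_power:
  assumes "0 \<le> x" "x < 1"
  shows "geometric_decay (\<lambda>m. of_real x ^ m)"
  unfolding geometric_decay_def using assms
  by (intro exI[of _ 1] exI[of _ x]) (auto simp: norm_power)

lemma geometric_decay_summable:
  assumes "geometric_decay B"
  shows "summable (\<lambda>m. norm (B m))"
proof -
  obtain D r where D: "0 \<le> r" "r < 1" "\<And>m. norm (B m) \<le> D * r ^ m"
    using assms unfolding geometric_decay_def by blast
  show ?thesis
    by (rule summable_comparison_test'[of "\<lambda>m. D * r ^ m" 0])
       (use D in \<open>auto intro!: summable_mult summable_geometric\<close>)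
qed

lemma geometric_decay_shift:
  assumes "geometric_decay B"
  shows "geometric_decay (\<lambda>m. B (m + n))"
proof -
  obtain D r where D: "0 \<le> r" "r < 1" "\<And>m. norm (B m) \<le> D * r ^ m"
    using assms unfolding geometric_decay_def by blast
  have "norm (B (m + n)) \<le> (D * r ^ n) * r ^ m" for m
    using D(3)[of "m + n"] by (simp add: power_add mult_ac)
  then show ?thesis unfolding geometric_decay_def using D by blast
qed

lemma geometric_decay_fdiff:
  assumes "geometric_decay B"
  shows "geometric_decay (fdiff B)"
proof -
  obtain D r where D: "0 \<le> r" "r < 1" "\<And>m. norm (B m) \<le> D * r ^ m"
    using assms unfolding geometric_decay_def by blast
  have "norm (fdiff B m) \<le> (D + D * r) * r ^ m" for m
    unfolding fdiff_def using norm_triangle_ineq4[of "B m" "B (Suc m)"] D(3)[of m] D(3)[of "Suc m"]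
    by (simp add: algebra_simps)
  then show ?thesis unfolding geometric_decay_def using D by blast
qed

section \<open>Summation against the coefficients of \<open>(1 - x) powr c\<close>\<close>

lemma one_minus_powr_coeff_bound:
  fixes c :: complex
  shows "\<exists>C. \<forall>j. norm (pochhammer (- c) j / fact j) \<le> C * real (Suc j) powr (- Re c - 1)"
  using pochhammer_ratio_bound[of 1 "- c"] by (simp add: pochhammer_fact)

lemma one_minus_powr_coeff_mult_summable:
  fixes c :: complex
  assumes "geometric_decay B"
  shows "summable (\<lambda>j. pochhammer (- c) j / fact j * B j)"
proof -
  obtain C where "\<And>j. norm (pochhammer (- c) j / fact j) \<le> C * real (Suc j) powr (- Re c - 1)"
    using one_minus_powr_coeff_bound by blast
  from geometric_decay_summable[OF geometric_decay_mult[OF assms this]]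
  show ?thesis by (rule summable_norm_cancel)
qed

text \<open>The factorisation of \<open>(1 - x) powr c\<close> into \<open>1 - x\<close> and
  \<open>(1 - x) powr (c - 1)\<close> makes its coefficients differences of those for
  \<open>c - 1\<close>. Summation by parts moves the difference onto \<open>B\<close>.\<close>

lemma one_minus_powr_coeff_suminf_fdiff:
  fixes c :: complex
  assumes "geometric_decay B"
  shows "(\<Sum>j. pochhammer (- c) j / fact j * B j) = (\<Sum>j. pochhammer (- (c - 1)) j / fact j * fdiff B j)"
proof -
  define e where "e = (\<lambda>c j. pochhammer (- c) j / fact j :: complex)"
  have e0: "e c 0 = 1" for c by (simp add: e_def)
  have e_Suc: "e c (Suc j) = e (c - 1) (Suc j) - e (c - 1) j" for j
  proof -
    have "pochhammer (- c) (Suc j) = - c * pochhammer (1 - c) j"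
      by (simp add: pochhammer_rec)
    moreover have "pochhammer (1 - c) (Suc j) = pochhammer (1 - c) j * (1 - c + of_nat j)"
      by (simp add: pochhammer_Suc)
    moreover have "1 + of_nat j \<noteq> (0 :: complex)"
      using of_nat_neq_0[of j, where ?'a = complex] by simp
    ultimately show ?thesis
      by (simp add: e_def divide_simps) (simp add: algebra_simps)
  qed
  have s: "summable (\<lambda>j. e d j * B (j + n))" for d n
    unfolding e_def by (intro one_minus_powr_coeff_mult_summable geometric_decay_shift assms)
  have s': "summable (\<lambda>j. e d (Suc j) * B (Suc j))" for d
    using s[of d 0] by (subst summable_Suc_iff) simp
  have "(\<Sum>j. e c j * B j) = (\<Sum>j. e c (Suc j) * B (Suc j)) + e c 0 * B 0"
    using suminf_split_head[of "\<lambda>j. e c j * B j"] s[of c 0] by simp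
  also have "(\<Sum>j. e c (Suc j) * B (Suc j)) = (\<Sum>j. e (c - 1) (Suc j) * B (Suc j)) - (\<Sum>j. e (c - 1) j * B (Suc j))"
    using s[of "c - 1" 1] s' by (subst suminf_diff) (auto simp: e_Suc algebra_simps)
  also have "(\<Sum>j. e (c - 1) (Suc j) * B (Suc j)) = (\<Sum>j. e (c - 1) j * B j) - e (c - 1) 0 * B 0"
    using suminf_split_head[of "\<lambda>j. e (c - 1) j * B j"] s[of "c - 1" 0] by simp
  finally have "(\<Sum>j. e c j * B j) = (\<Sum>j. e (c - 1) j * B j) - (\<Sum>j. e (c - 1) j * B (Suc j))"
    by (simp add: e0)
  also have "\<dots> = (\<Sum>j. e (c - 1) j * fdiff B j)"
    using s[of "c - 1" 0] s[of "c - 1" 1] by (subst suminf_diff) (auto simp: fdiff_def algebra_simps)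
  finally show ?thesis unfolding e_def .
qed

lemma one_minus_powr_coeff_suminf_fdiff_funpow:
  fixes c :: complex
  assumes "geometric_decay B"
  shows "(\<Sum>j. pochhammer (- c) j / fact j * B j) =
    (\<Sum>j. pochhammer (- (c - of_nat l)) j / fact j * (fdiff ^^ l) B j)"
  using assms
proof (induction l arbitrary: c B)
  case (Suc l)
  have "(\<Sum>j. pochhammer (- c) j / fact j * B j) =
      (\<Sum>j. pochhammer (- (c - 1 - of_nat l)) j / fact j * (fdiff ^^ l) (fdiff B) j)"
    using one_minus_powr_coeff_suminf_fdiff[OF Suc.prems, of c] Suc.IH[OF geometric_decay_fdiff[OF Suc.prems], of "c - 1"]
    by simp
  then show ?case by (simp add: funpow_swap1 diff_diff_eq)
qed simp

text \<open>
  Taking \<open>l \<ge> Re c\<close> integer differences first leaves a sum of order \<open>c - l\<close>, which converges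
  absolutely; the loss \<open>eps\<close> allows the factors \<open>j\<close> and \<open>n\<close> to be separated.
\<close>
lemma fractional_difference_bound:
  fixes c :: complex
  assumes F: "symbol_class I r F" and decay: "\<And>i. i \<in> I \<Longrightarrow> geometric_decay (F i)"
    and eps: "eps > 0" "r - Re c + eps \<le> 0"
  shows "\<exists>K\<ge>0. \<forall>i\<in>I. \<forall>n. norm (\<Sum>j. pochhammer (- c) j / fact j * F i (j + n)) \<le>
    K * real (Suc n) powr (r - Re c + eps)"
proof -
  \<comment> \<open>No differences are taken if \<open>Re c <= 0\<close>; in every case
    \<open>k = l - Re c\<close> is nonnegative.\<close>
  define l where "l = nat \<lceil>Re c\<rceil>"
  define k where "k = real l - Re c"
  have k: "k \<ge> 0" unfolding k_def l_def by linarith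
  obtain C where C: "\<And>j. norm (pochhammer (- (c - of_nat l)) j / fact j) \<le> C * real (Suc j) powr (k - 1)"
    using one_minus_powr_coeff_bound[of "c - of_nat l"] by (auto simp: k_def)
  obtain D where D: "D \<ge> 0" "\<And>i m. i \<in> I \<Longrightarrow> norm ((fdiff ^^ l) (F i) m) \<le> D * real (Suc m) powr (r - real l)"
    using F unfolding symbol_class_def by blast
  have C0: "C \<ge> 0" using order_trans[OF norm_ge_zero C[of 0]] by simp
  have "summable (\<lambda>j. real j powr (- 1 - eps))"
    using eps by (subst summable_real_powr_iff) auto
  then have S: "summable (\<lambda>j. real (Suc j) powr (- 1 - eps))"
    by (subst summable_Suc_iff)
  define K where "K = (\<Sum>j. real (Suc j) powr (- 1 - eps))"
  have K: "K \<ge> 0" unfolding K_def by (intro suminf_nonneg S) simp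
  have "norm (\<Sum>j. pochhammer (- c) j / fact j * F i (j + n)) \<le>
      C * D * K * real (Suc n) powr (r - Re c + eps)" if i: "i \<in> I" for i n
  proof -
    define B where "B = (\<lambda>j. F i (j + n))"
    have summand: "norm (pochhammer (- (c - of_nat l)) j / fact j * (fdiff ^^ l) B j) \<le>
        C * D * real (Suc n) powr (r - Re c + eps) * real (Suc j) powr (- 1 - eps)" for j
    proof -
      \<comment> \<open>Both exponents on the right are nonpositive, so \<open>j + n\<close> may be
        decreased to \<open>j\<close> in one factor and to \<open>n\<close> in the other. The
        exponent \<open>- k - eps\<close> is what turns \<open>k - 1\<close> into the summable
        \<open>- 1 - eps\<close>.\<close>
      have "real (Suc (j + n)) powr (r - real l) =
          real (Suc (j + n)) powr (- k - eps) * real (Suc (j + n)) powr (r - Re c + eps)"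
        by (simp add: k_def flip: powr_add del: of_nat_Suc)
      also have "\<dots> \<le> real (Suc j) powr (- k - eps) * real (Suc n) powr (r - Re c + eps)"
        using k eps by (intro mult_mono powr_mono2') auto
      finally have le: "real (Suc (j + n)) powr (r - real l) \<le>
          real (Suc j) powr (- k - eps) * real (Suc n) powr (r - Re c + eps)" .
      have "norm ((fdiff ^^ l) B j) \<le> D * real (Suc (j + n)) powr (r - real l)"
        unfolding B_def fdiff_funpow_shift using D i by blast
      also have "\<dots> \<le> D * (real (Suc j) powr (- k - eps) * real (Suc n) powr (r - Re c + eps))"
        using D(1) le by (intro mult_left_mono)
      finally have "norm (pochhammer (- (c - of_nat l)) j / fact j * (fdiff ^^ l) B j) \<le>
        (C * real (Suc j) powr (k - 1)) * (D * (real (Suc j) powr (- k - eps) * real (Suc n) powr (r - Re c + eps)))"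
        unfolding norm_mult using C0 by (intro mult_mono C) auto
      also have "\<dots> = C * D * real (Suc n) powr (r - Re c + eps) *
          (real (Suc j) powr (k - 1) * real (Suc j) powr (- k - eps))"
        by (simp only: mult_ac)
      also have "real (Suc j) powr (k - 1) * real (Suc j) powr (- k - eps) = real (Suc j) powr (- 1 - eps)"
        by (simp flip: powr_add del: of_nat_Suc)
      finally show ?thesis .
    qed
    have "norm (\<Sum>j. pochhammer (- c) j / fact j * B j) =
        norm (\<Sum>j. pochhammer (- (c - of_nat l)) j / fact j * (fdiff ^^ l) B j)"
      unfolding B_def
      by (subst one_minus_powr_coeff_suminf_fdiff_funpow[OF geometric_decay_shift[OF decay[OF i]], of c n l]) simp
    also have "\<dots> \<le> (\<Sum>j. C * D * real (Suc n) powr (r - Re c + eps) * real (Suc j) powr (- 1 - eps))"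
      by (intro norm_suminf_le summand summable_mult S)
    also have "\<dots> = C * D * real (Suc n) powr (r - Re c + eps) * K"
      unfolding K_def by (intro suminf_mult S)
    finally show ?thesis by (simp add: B_def mult_ac)
  qed
  then show ?thesis using C0 D(1) K by (intro exI[of _ "C * D * K"]) auto
qed

subsection \<open>Terms of hypergeometric series\<close>

lemma vpoch_Nil [simp]: "vpoch [] n = 1"
  by (simp add: vpoch_def)

lemma vpoch_Cons [simp]: "vpoch (z # a) n = pochhammer z n * vpoch a n"
  by (simp add: vpoch_def)

lemma vpoch_append [simp]: "vpoch (a @ b) n = vpoch a n * vpoch b n"
  by (simp add: vpoch_def)

text \<open>Parameters equal to 1 pad lists to equal length, as
  \<open>pochhammer_ratio_bound_list\<close> requires, at the price of factorials.\<close>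

lemma vpoch_replicate_1: "vpoch (replicate r 1) n = fact n ^ r"
  by (induction r) (simp_all flip: pochhammer_fact)

lemma vpoch_add: "vpoch a (n + j) = vpoch a n * vpoch (vshift a (of_nat n)) j"
  by (induction a) (simp_all add: vshift_def pochhammer_product')

lemma vpoch_nonzero:
  assumes "set b \<inter> \<int>\<^sub>\<le>\<^sub>0 = {}"
  shows "vpoch b n \<noteq> 0"
  using assms by (induction b) (auto dest: pochhammer_nonpos_Int_nonzero)

lemma vpoch_eq_0:
  assumes "- of_nat n \<in> set a" "n < m"
  shows "vpoch a m = 0"
  using assms by (induction a) (auto simp: pochhammer_of_nat_eq_0_lemma)

lemma vpoch_eq_0_mono:
  assumes "vpoch a n = 0" "n \<le> m"
  shows "vpoch a m = 0"
  using vpoch_add[of a n "m - n"] assms by simp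

text \<open>The multiplication formula of Gauss for Pochhammer symbols: passing from
  \<open>n\<close> to \<open>n + 1\<close> appends \<open>w\<close> consecutive factors, one to each
  of the \<open>w\<close> symbols, with \<open>w\<close> taken out of every factor.\<close>

lemma pochhammer_mult_nat:
  fixes z :: complex
  assumes "w \<ge> 1"
  shows "pochhammer z (w * n) = of_nat w ^ (w * n) * (\<Prod>i<w. pochhammer ((z + of_nat i) / of_nat w) n)"
proof (induction n)
  case (Suc n)
  have "pochhammer z (w * Suc n) = pochhammer z (w * n) * pochhammer (z + of_nat (w * n)) w"
    using pochhammer_product'[of z "w * n" w] by (simp add: add.commute)
  also have "pochhammer (z + of_nat (w * n)) w =
      (\<Prod>i<w. of_nat w * ((z + of_nat i) / of_nat w + of_nat n))"
    unfolding pochhammer_prod atLeast0LessThan using assms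
    by (intro prod.cong refl) (simp add: field_simps)
  also have "\<dots> = of_nat w ^ w * (\<Prod>i<w. (z + of_nat i) / of_nat w + of_nat n)"
    by (simp only: prod.distrib prod_constant card_lessThan)
  finally show ?case
    unfolding Suc.IH by (simp only: pochhammer_Suc prod.distrib mult_Suc_right power_add mult_ac)
qed simp

lemma vpoch_Delta:
  assumes "w \<ge> 1"
  shows "vpoch a (w * n) = of_nat w ^ (w * n * length a) * vpoch (Delta a w) n"
proof (induction a)
  case (Cons z a)
  have "vpoch (map (\<lambda>i. (z + of_nat i) / of_nat w) [0..<w]) n =
      (\<Prod>i<w. pochhammer ((z + of_nat i) / of_nat w) n)"
    unfolding vpoch_def map_map o_def atLeast0LessThan[symmetric] atLeastLessThan_upt
    by (subst prod.distinct_set_conv_list) auto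
  moreover have "Delta (z # a) w = map (\<lambda>i. (z + of_nat i) / of_nat w) [0..<w] @ Delta a w"
    by (simp add: Delta_def)
  ultimately show ?case
    using Cons pochhammer_mult_nat[OF assms, of z n] by (simp add: power_add mult_ac)
qed (simp add: Delta_def)

text \<open>The powers of \<open>w\<close> cancel because \<open>a\<close> and \<open>b\<close> have
  equal length. Inserting the \<open>Delta\<close> parameters thus samples the Pochhammer quotient
  at the multiples of \<open>w\<close>.\<close>

lemma hyp_term_Delta:
  assumes "w \<ge> 1" "length a = length b"
  shows "hyp_term (alpha @ Delta a w) (beta @ Delta b w) M n =
    hyp_term alpha beta M n * (vpoch a (w * n) / vpoch b (w * n))"
proof -
  define c :: complex where "c = of_nat w ^ (w * n * length b)"
  have "c \<noteq> 0" using assms by (simp add: c_def)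
  moreover have "vpoch a (w * n) = c * vpoch (Delta a w) n" "vpoch b (w * n) = c * vpoch (Delta b w) n"
    using vpoch_Delta[OF assms(1), of a n] vpoch_Delta[OF assms(1), of b n] assms(2)
    by (simp_all only: c_def)
  ultimately have "vpoch a (w * n) / vpoch b (w * n) = vpoch (Delta a w) n / vpoch (Delta b w) n"
    by simp
  then show ?thesis by (simp add: hyp_term_def mult_ac)
qed

text \<open>With \<open>n = u * k\<close> this absorbs the outer factor of the \<open>k\<close>-th
  summand into the inner series, leaving the quotient at the total index
  \<open>n + j\<close>.\<close>

lemma hyp_term_vshift:
  "vpoch a n / vpoch b n * hyp_term (c # vshift a (of_nat n)) (vshift b (of_nat n)) 1 j =
    pochhammer c j / fact j * (vpoch a (n + j) / vpoch b (n + j))"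
  by (simp add: hyp_term_def vpoch_add mult_ac)

text \<open>The power of \<open>k\<close> is bounded by a multiple of \<open>2 ^ k\<close>, and the
  exponential series of \<open>2 * x\<close> has terms tending to 0.\<close>

lemma powr_times_power_over_fact:
  fixes p x :: real
  assumes "x > 0"
  shows "(\<lambda>k. real (Suc k) powr p * x ^ k / fact k) \<longlonglongrightarrow> 0"
proof -
  obtain C r where C: "C \<ge> 0" "0 \<le> r" "r < 1" "\<And>m. real (Suc m) powr p * (1/2) ^ m \<le> C * r ^ m"
    using polynomial_times_geometric[of "1/2" p] by auto
  have "norm (real (Suc k) powr p * x ^ k / fact k) \<le> C * (inverse (fact k) * (2 * x) ^ k)" for k
  proof -
    have "real (Suc k) powr p * (1/2) ^ k \<le> C * 1"
      using C by (intro order_trans[OF C(4)] mult_left_mono power_le_one) auto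
    then have "(real (Suc k) powr p * (1/2) ^ k) * ((2 * x) ^ k / fact k) \<le> C * ((2 * x) ^ k / fact k)"
      using assms by (intro mult_right_mono) auto
    moreover have "(1/2) ^ k * (2 * x) ^ k = x ^ k"
      by (simp add: power_mult_distrib power_divide)
    ultimately show ?thesis using assms by (simp add: field_simps)
  qed
  then have "eventually (\<lambda>k. norm (real (Suc k) powr p * x ^ k / fact k) \<le>
      C * (inverse (fact k) * (2 * x) ^ k)) sequentially"
    by (intro always_eventually allI)
  moreover have "(\<lambda>k. C * (inverse (fact k) * (2 * x) ^ k)) \<longlonglongrightarrow> 0"
    by (rule tendsto_mult_right_zero[OF summable_LIMSEQ_zero[OF summable_exp]])
  ultimately show ?thesis by (rule Lim_null_comparison)
qed

text \<open>With two or more surplus upper parameters, nonvanishing terms grow at least like a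
  factorial up to powers of \<open>k\<close> and geometric factors. Boundedness of the terms at a
  positive point excludes this.\<close>

lemma hyp_term_long_terminates:
  assumes "fps_conv_radius (Abs_fps (hyp_term d g 1)) > 0"
    and g: "set g \<inter> \<int>\<^sub>\<le>\<^sub>0 = {}" and len: "length g + 1 < length d"
  shows "set d \<inter> \<int>\<^sub>\<le>\<^sub>0 \<noteq> {}"
proof
  assume d: "set d \<inter> \<int>\<^sub>\<le>\<^sub>0 = {}"
  obtain x :: real where x: "x > 0" "ereal x < conv_radius (hyp_term d g 1)"
    using assms(1) ereal_dense2[of 0 "conv_radius (hyp_term d g 1)"]
    by (auto simp: fps_conv_radius_def)
  have "summable (\<lambda>k. hyp_term d g 1 k * of_real x ^ k)"
    using x by (intro summable_in_conv_radius) simp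
  then have "(\<lambda>k. hyp_term d g 1 k * of_real x ^ k) \<longlonglongrightarrow> 0"
    by (rule summable_LIMSEQ_zero)
  from convergent_imp_Bseq[OF convergentI[OF this]]
  obtain K where K: "\<And>k. norm (hyp_term d g 1 k * of_real x ^ k) \<le> K"
    unfolding Bseq_def by blast
  define n where "n = length d - length g - 1"
  have n: "n \<ge> 1" "length ((1 # g) @ replicate n 1) = length d"
    using len by (auto simp: n_def)
  obtain C p where C: "\<And>k. norm (vpoch ((1 # g) @ replicate n 1) k / vpoch d k) \<le> C * real (Suc k) powr p"
    using pochhammer_ratio_bound_list[OF n(2) d] by blast
  have C0: "C \<ge> 0" using order_trans[OF norm_ge_zero C[of 0]] by simp
  have K0: "K \<ge> 0" using order_trans[OF norm_ge_zero K[of 0]] .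
  have "1 \<le> C * K * (real (Suc k) powr p * (1 / x) ^ k / fact k)" for k
  proof -
    have nz: "vpoch d k \<noteq> 0" "vpoch g k \<noteq> 0" using d g vpoch_nonzero by blast+
    have "vpoch ((1 # g) @ replicate n 1) k / vpoch d k * (hyp_term d g 1 k * of_real x ^ k) =
        fact k ^ n * of_real x ^ k"
      using nz by (simp add: hyp_term_def vpoch_replicate_1 flip: pochhammer_fact)
    then have "norm (fact k ^ n * of_real x ^ k :: complex) =
      norm (vpoch ((1 # g) @ replicate n 1) k / vpoch d k) * norm (hyp_term d g 1 k * of_real x ^ k)"
      by (metis norm_mult)
    also have "\<dots> \<le> (C * real (Suc k) powr p) * K"
      using C0 by (intro mult_mono C K) auto
    finally have "fact k ^ n * x ^ k \<le> C * real (Suc k) powr p * K"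
      using x by (simp add: norm_mult norm_power)
    moreover have "fact k ^ 1 * x ^ k \<le> fact k ^ n * x ^ k"
      using n x by (intro mult_right_mono power_increasing) auto
    ultimately have "fact k * x ^ k \<le> C * real (Suc k) powr p * K" by simp
    then show ?thesis using x by (simp add: field_simps)
  qed
  moreover have "(\<lambda>k. C * K * (real (Suc k) powr p * (1 / x) ^ k / fact k)) \<longlonglongrightarrow> 0"
    using x by (intro tendsto_mult_right_zero[OF powr_times_power_over_fact]) simp
  ultimately have "(1 :: real) \<le> 0"
    using LIMSEQ_le_const by blast
  then show False by simp
qed

text \<open>A terminating series is trivial. With exactly one surplus upper parameter,
  \<open>fact k\<close> is the Pochhammer symbol of a lower parameter 1 and the term is a balanced
  quotient, whence the \<open>- 1\<close> in the exponent. With fewer upper parameters the terms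
  decay factorially.\<close>

lemma hyp_term_bound:
  assumes "fps_conv_radius (Abs_fps (hyp_term d g 1)) > 0" and g: "set g \<inter> \<int>\<^sub>\<le>\<^sub>0 = {}"
  shows "\<exists>C\<ge>0. \<forall>k. norm (hyp_term d g 1 k) \<le> C * real (Suc k) powr (Re (sum_list d - sum_list g) - 1)"
proof -
  define p where "p = Re (sum_list d - sum_list g) - 1"
  have bseq: ?thesis if B: "Bseq (\<lambda>k. hyp_term d g 1 k / of_real (real (Suc k) powr p))"
  proof -
    obtain C where C: "C > 0" "\<forall>k. norm (hyp_term d g 1 k / of_real (real (Suc k) powr p)) \<le> C"
      using B by (rule BseqE) blast
    have "norm (hyp_term d g 1 k) \<le> C * real (Suc k) powr p" for k
      using spec[OF C(2), of k] by (simp add: norm_divide divide_simps del: of_nat_Suc)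
    then show ?thesis using C(1) unfolding p_def by (intro exI[of _ C]) auto
  qed
  consider "set d \<inter> \<int>\<^sub>\<le>\<^sub>0 \<noteq> {}" | "length d = length (1 # g)" | "length d \<le> length g"
    using hyp_term_long_terminates[OF assms] by force
  then show ?thesis
  proof cases
    case 1
    then obtain n where n: "- of_nat n \<in> set d"
      by (auto elim: nonpos_Ints_cases')
    have "eventually (\<lambda>k. hyp_term d g 1 k / of_real (real (Suc k) powr p) = 0) sequentially"
      using eventually_gt_at_top[of n] by eventually_elim (simp add: hyp_term_def vpoch_eq_0[OF n])
    then have "(\<lambda>k. hyp_term d g 1 k / of_real (real (Suc k) powr p)) \<longlonglongrightarrow> 0"
      by (rule tendsto_eventually)
    then show ?thesis by (intro bseq convergent_imp_Bseq convergentI)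
  next
    case 2
    have "set (1 # g) \<inter> \<int>\<^sub>\<le>\<^sub>0 = {}" using g by auto
    from pochhammer_ratio_bound_list[OF 2 this] obtain C where
      C: "\<And>k. norm (vpoch d k / vpoch (1 # g) k) \<le> C * real (Suc k) powr Re (sum_list d - sum_list (1 # g))"
      by blast
    have "norm (hyp_term d g 1 k) \<le> C * real (Suc k) powr p" for k
      using C[of k] by (simp add: hyp_term_def p_def mult.commute diff_diff_eq add.commute flip: pochhammer_fact)
    moreover have "C \<ge> 0" using order_trans[OF norm_ge_zero C[of 0]] by simp
    ultimately show ?thesis unfolding p_def by blast
  next
    case 3
    define n where "n = length g - length d"
    have len: "length (d @ replicate n 1) = length g" using 3 by (simp add: n_def)
    obtain C s where C: "\<And>k. norm (vpoch (d @ replicate n 1) k / vpoch g k) \<le> C * real (Suc k) powr s"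
      using pochhammer_ratio_bound_list[OF len g] by blast
    have C0: "C \<ge> 0" using order_trans[OF norm_ge_zero C[of 0]] by simp
    have "(\<lambda>k. hyp_term d g 1 k / of_real (real (Suc k) powr p)) \<longlonglongrightarrow> 0"
    proof (rule Lim_null_comparison)
      have "norm (hyp_term d g 1 k / of_real (real (Suc k) powr p)) \<le>
          C * (real (Suc k) powr (s - p) * 1 ^ k / fact k)" for k
      proof -
        \<comment> \<open>Padding the upper list by ones only enlarges the quotient, which is
          therefore bounded by a power of \<open>k\<close>; the remaining \<open>fact k\<close> in
          the denominator beats every power.\<close>
        have "norm (vpoch d k / vpoch g k) * 1 \<le> norm (vpoch d k / vpoch g k) * fact k ^ n"
          by (intro mult_left_mono one_le_power) auto
        also have "\<dots> = norm (vpoch (d @ replicate n 1) k / vpoch g k)"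
          by (simp add: vpoch_replicate_1 norm_mult norm_divide norm_power)
        also have "\<dots> \<le> C * real (Suc k) powr s" by (rule C)
        finally have "norm (vpoch d k / vpoch g k) \<le> C * real (Suc k) powr s" by simp
        then have "norm (vpoch d k / vpoch g k) / (fact k * real (Suc k) powr p) \<le>
            C * real (Suc k) powr s / (fact k * real (Suc k) powr p)"
          by (intro divide_right_mono) auto
        then show ?thesis
          by (simp add: hyp_term_def norm_mult norm_divide powr_diff mult_ac del: of_nat_Suc)
      qed
      then show "eventually (\<lambda>k. norm (hyp_term d g 1 k / of_real (real (Suc k) powr p)) \<le>
          C * (real (Suc k) powr (s - p) * 1 ^ k / fact k)) sequentially" by simp
      show "(\<lambda>k. C * (real (Suc k) powr (s - p) * 1 ^ k / fact k)) \<longlonglongrightarrow> 0"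
        by (intro tendsto_mult_right_zero[OF powr_times_power_over_fact]) simp
    qed
    then show ?thesis by (intro bseq convergent_imp_Bseq convergentI)
  qed
qed

subsection \<open>Interchange of summation\<close>

lemma
  fixes u m :: nat
  assumes "u \<ge> 1"
  shows mult_le_subset_atMost: "{k. u * k \<le> m} \<subseteq> {..m}"
    and finite_mult_le: "finite {k. u * k \<le> m}"
proof -
  have "k \<le> u * k" for k using assms by simp
  then show "{k. u * k \<le> m} \<subseteq> {..m}" using order_trans by blast
  then show "finite {k. u * k \<le> m}" by (rule finite_subset) simp
qed

lemma sums_regroup_finite:
  fixes q A T :: "nat \<Rightarrow> complex" and e :: "nat \<Rightarrow> nat \<Rightarrow> complex"
  assumes "\<And>k. k < K \<Longrightarrow> (\<lambda>j. q k * (e k j * A (u * k + j))) sums T k"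
  shows "(\<lambda>m. A m * (\<Sum>k | k < K \<and> u * k \<le> m. q k * e k (m - u * k))) sums (\<Sum>k<K. T k)"
proof -
  define f where "f = (\<lambda>k m. if u * k \<le> m then q k * (e k (m - u * k) * A m) else 0)"
  have "f k sums T k" if "k < K" for k
  proof -
    have "(\<lambda>j. f k (j + u * k)) sums T k"
      using assms[OF that] by (simp add: f_def add.commute)
    then have "f k sums (T k + (\<Sum>i<u * k. f k i))"
      by (subst (asm) sums_iff_shift)
    also have "(\<Sum>i<u * k. f k i) = 0" by (simp add: f_def)
    finally show ?thesis by simp
  qed
  then have "(\<lambda>m. \<Sum>k<K. f k m) sums (\<Sum>k<K. T k)"
    by (intro sums_sum) auto
  moreover have "(\<Sum>k<K. f k m) = A m * (\<Sum>k | k < K \<and> u * k \<le> m. q k * e k (m - u * k))" for m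
  proof -
    have "(\<Sum>k<K. f k m) = (\<Sum>k | k < K \<and> u * k \<le> m. q k * (e k (m - u * k) * A m))"
      unfolding f_def by (intro sum.mono_neutral_cong_right) auto
    then show ?thesis by (simp add: sum_distrib_left mult_ac)
  qed
  ultimately show ?thesis by simp
qed

text \<open>The exchange of limits for case (ii). The two inequalities on \<open>r\<close>,
  \<open>p\<close> and \<open>Re c\<close> make the bound on the fractional difference nonincreasing
  in the index and its product with the bound on \<open>q\<close> summable.\<close>

lemma sums_regroup_symbol:
  fixes q R :: "nat \<Rightarrow> complex" and c S :: complex
  assumes u: "u \<ge> 1" and ab: "length a = length b" "set b \<inter> \<int>\<^sub>\<le>\<^sub>0 = {}"
    and q: "\<And>k. norm (q k) \<le> Cq * real (Suc k) powr p"
    and r: "r = Re (sum_list a - sum_list b)" "r - Re c < 0" "p + r - Re c < - 1"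
    and A: "A = (\<lambda>m. vpoch a m / vpoch b m)"
    and R: "\<And>k. (\<lambda>j. q k * (pochhammer (- c) j / fact j * A (u * k + j))) sums R k"
    and S: "(\<lambda>m. A m * (\<Sum>k | u * k \<le> m. q k * (pochhammer (- c) (m - u * k) / fact (m - u * k)))) sums S"
  shows "R sums S"
proof -
  define I where "I = {0<..<(1::real)}"
  define e where "e = (\<lambda>j. pochhammer (- c) j / fact j :: complex)"
  define F where "F = (\<lambda>(x::real) m. A m * of_real x ^ m)"
  define C where "C = (\<lambda>m. \<Sum>k | u * k \<le> m. q k * e (m - u * k))"
  define t where "t = (\<lambda>k x. q k * (\<Sum>j. e j * F x (j + u * k)))"
  have Cq: "Cq \<ge> 0" using order_trans[OF norm_ge_zero q[of 0]] by simp
  have le: "k \<le> u * k" for k using u by simp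
  obtain CA where CA: "\<And>m. norm (A m) \<le> CA * real (Suc m) powr r"
    using pochhammer_ratio_bound_list[OF ab] unfolding A r(1) by blast
  have F_decay: "geometric_decay (F x)" if "x \<in> I" for x
    using geometric_decay_mult[OF geometric_decay_power CA] that by (auto simp: F_def I_def)
  have "symbol_class {0..1} r F"
    using symbol_class_vpoch_ratio_power[OF ab] by (simp add: F_def A r(1))
  then have F_symbol: "symbol_class I r F"
    unfolding symbol_class_def I_def by (meson greaterThanLessThan_subseteq_atLeastAtMost_iff order_refl subsetD)
  \<comment> \<open>Half of the smaller slack, so that the loss \<open>eps\<close> leaves both
    inequalities strict.\<close>
  define eps where "eps = min (Re c - r) (- 1 - (p + r - Re c)) / 2"
  have eps: "eps > 0" "r - Re c + eps \<le> 0" "p + r - Re c + eps < - 1"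
  proof -
    have "eps \<le> (Re c - r) / 2" "eps \<le> (- 1 - (p + r - Re c)) / 2"
      by (simp_all add: eps_def min_def)
    then show "eps > 0" "r - Re c + eps \<le> 0" "p + r - Re c + eps < - 1"
      using r(2,3) by (simp_all add: eps_def field_simps)
  qed
  obtain K where K: "K \<ge> 0"
    "\<And>x n. x \<in> I \<Longrightarrow> norm (\<Sum>j. e j * F x (j + n)) \<le> K * real (Suc n) powr (r - Re c + eps)"
    using fractional_difference_bound[OF F_symbol F_decay eps(1,2)] unfolding e_def by blast
  define M where "M = (\<lambda>k. Cq * K * real (Suc k) powr (p + r - Re c + eps))"
  have "summable (\<lambda>k. real k powr (p + r - Re c + eps))"
    using eps by (subst summable_real_powr_iff) auto
  then have M: "summable M"
    unfolding M_def by (intro summable_mult) (subst summable_Suc_iff)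
  have t_bound: "norm (t k x) \<le> M k" if "x \<in> I" for k x
  proof -
    have "norm (\<Sum>j. e j * F x (j + u * k)) \<le> K * real (Suc (u * k)) powr (r - Re c + eps)"
      by (rule K(2)[OF that])
    also have "\<dots> \<le> K * real (Suc k) powr (r - Re c + eps)"
      using K(1) eps le[of k] by (intro mult_left_mono powr_mono2') (auto simp flip: of_nat_mult)
    finally have "norm (t k x) \<le> (Cq * real (Suc k) powr p) * (K * real (Suc k) powr (r - Re c + eps))"
      unfolding t_def norm_mult using Cq by (intro mult_mono q) auto
    also have "\<dots> = Cq * K * (real (Suc k) powr p * real (Suc k) powr (r - Re c + eps))"
      by (simp only: mult_ac)
    also have "\<dots> = M k"
      unfolding M_def powr_add[symmetric] by (simp add: algebra_simps)
    finally show ?thesis .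
  qed
  have at1: "eventually (\<lambda>x::real. x \<in> I) (at_left 1)"
    unfolding I_def by (rule eventually_at_left_real) simp
  \<comment> \<open>The sum in \<open>t k x\<close> carries \<open>x ^ (j + u * k)\<close>; up to
    the factor \<open>x ^ (u * k)\<close>, which tends to 1, it is the Abel mean of the
    \<open>k\<close>-th inner series.\<close>
  have t_limit: "((\<lambda>x. t k x) \<longlongrightarrow> R k) (at_left 1)" for k
  proof -
    define n where "n = u * k"
    have "((\<lambda>x::real. \<Sum>j. q k * (e j * A (n + j)) * of_real x ^ j) \<longlongrightarrow> R k) (at_left 1)"
      using Abel_limit_theorem[OF R[of k]] by (simp add: n_def e_def)
    then have "((\<lambda>x::real. of_real x ^ n * (\<Sum>j. q k * (e j * A (n + j)) * of_real x ^ j))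
        \<longlongrightarrow> of_real 1 ^ n * R k) (at_left 1)"
      by (intro tendsto_intros)
    moreover have "eventually (\<lambda>x::real. of_real x ^ n * (\<Sum>j. q k * (e j * A (n + j)) * of_real x ^ j) = t k x) (at_left 1)"
      using at1
    proof eventually_elim
      case (elim x)
      then have x: "x \<in> I" "x \<noteq> 0" by (auto simp: I_def)
      have "summable (\<lambda>j. e j * F x (j + n))"
        unfolding e_def by (intro one_minus_powr_coeff_mult_summable geometric_decay_shift F_decay x)
      then have "(\<Sum>j. q k / of_real x ^ n * (e j * F x (j + n))) = q k / of_real x ^ n * (\<Sum>j. e j * F x (j + n))"
        by (rule suminf_mult)
      moreover have "q k / of_real x ^ n * (e j * F x (j + n)) = q k * (e j * A (n + j)) * of_real x ^ j" for j
        using x by (simp add: F_def power_add add.commute)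
      ultimately show ?case
        using x by (simp add: t_def n_def)
    qed
    ultimately have "((\<lambda>x. t k x) \<longlongrightarrow> of_real 1 ^ n * R k) (at_left 1)"
      by (rule Lim_transform_eventually)
    then show ?thesis by simp
  qed
  \<comment> \<open>At fixed \<open>x < 1\<close> the sum is truncated at \<open>k < N\<close> and
    regrouped, and then \<open>N\<close> tends to infinity. Each \<open>h m N\<close> is constant in
    \<open>N\<close> once \<open>N > m\<close>, and \<open>g m * norm (F x m)\<close>
    dominates.\<close>
  have t_sums: "(\<lambda>k. t k x) sums (\<Sum>m. A m * C m * of_real x ^ m)" if x: "x \<in> I" for x
  proof -
    define h where "h = (\<lambda>m N. F x m * (\<Sum>k | k < N \<and> u * k \<le> m. q k * e (m - u * k)))"
    define g where "g = (\<lambda>m. \<Sum>k | u * k \<le> m. norm (q k * e (m - u * k)))"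
    note fin = finite_mult_le[OF u] mult_le_subset_atMost[OF u]
    have partial: "(\<Sum>k<N. t k x) = (\<Sum>m. h m N)" for N
    proof -
      have "(\<lambda>j. q k * (e j * F x (u * k + j))) sums t k x" for k
      proof -
        have "summable (\<lambda>j. e j * F x (j + u * k))"
          unfolding e_def by (intro one_minus_powr_coeff_mult_summable geometric_decay_shift F_decay x)
        then show ?thesis unfolding t_def by (simp add: sums_mult summable_sums add.commute)
      qed
      then have "(\<lambda>m. F x m * (\<Sum>k | k < N \<and> u * k \<le> m. q k * e (m - u * k))) sums (\<Sum>k<N. t k x)"
        by (rule sums_regroup_finite)
      then show ?thesis by (simp add: h_def sums_iff)
    qed
    have h_limit: "(\<lambda>N. h m N) \<longlonglongrightarrow> A m * C m * of_real x ^ m" for m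
    proof (rule tendsto_eventually)
      show "eventually (\<lambda>N. h m N = A m * C m * of_real x ^ m) sequentially"
        using eventually_gt_at_top[of m]
      proof eventually_elim
        case (elim N)
        then have "{k. k < N \<and> u * k \<le> m} = {k. u * k \<le> m}" using fin(2)[of m] by auto
        then show ?case by (simp add: h_def F_def C_def mult_ac)
      qed
    qed
    have h_bound: "norm (h m N) \<le> norm (g m * F x m)" for m N
    proof -
      have "norm (\<Sum>k | k < N \<and> u * k \<le> m. q k * e (m - u * k)) \<le>
          (\<Sum>k | k < N \<and> u * k \<le> m. norm (q k * e (m - u * k)))"
        by (rule norm_sum)
      also have "\<dots> \<le> g m"
        unfolding g_def using fin by (intro sum_mono2) auto
      finally have "norm (\<Sum>k | k < N \<and> u * k \<le> m. q k * e (m - u * k)) \<le> \<bar>g m\<bar>" by simp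
      then have "norm (\<Sum>k | k < N \<and> u * k \<le> m. q k * e (m - u * k)) * norm (F x m) \<le> \<bar>g m\<bar> * norm (F x m)"
        by (rule mult_right_mono) simp
      then show ?thesis by (simp add: h_def norm_mult mult.commute)
    qed
    obtain Ce where Ce: "\<And>j. norm (e j) \<le> Ce * real (Suc j) powr (- Re c - 1)"
      using one_minus_powr_coeff_bound unfolding e_def by blast
    have Ce0: "Ce \<ge> 0" using order_trans[OF norm_ge_zero Ce[of 0]] by simp
    define s where "s = \<bar>- Re c - 1\<bar>"
    have mono: "real (Suc k) powr v \<le> real (Suc m) powr \<bar>v\<bar>" if "k \<le> m" for k m v
    proof -
      have "real (Suc k) powr v \<le> real (Suc k) powr \<bar>v\<bar>" by (intro powr_mono) auto
      also have "\<dots> \<le> real (Suc m) powr \<bar>v\<bar>" using that by (intro powr_mono2) auto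
      finally show ?thesis .
    qed
    \<comment> \<open>At most \<open>m + 1\<close> values of \<open>k\<close> occur, giving the 1 in
      the exponent. Absolute values of exponents allow every index to be raised to \<open>m\<close>;
      crude growth suffices against geometric decay.\<close>
    have g_bound: "norm (of_real (g m) :: complex) \<le> (Cq * Ce) * real (Suc m) powr (1 + \<bar>p\<bar> + s)" for m
    proof -
      have "g m \<le> (\<Sum>k | u * k \<le> m. (Cq * real (Suc m) powr \<bar>p\<bar>) * (Ce * real (Suc m) powr s))"
        unfolding g_def norm_mult
      proof (intro sum_mono mult_mono)
        fix k assume "k \<in> {k. u * k \<le> m}"
        then have k: "k \<le> m" using fin(2)[of m] by auto
        show "norm (q k) \<le> Cq * real (Suc m) powr \<bar>p\<bar>"
          by (rule order_trans[OF q]) (intro mult_left_mono mono k Cq)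
        show "norm (e (m - u * k)) \<le> Ce * real (Suc m) powr s"
          unfolding s_def by (rule order_trans[OF Ce]) (intro mult_left_mono mono Ce0, simp)
      qed (use Cq in auto)
      also have "\<dots> \<le> real (Suc m) * ((Cq * real (Suc m) powr \<bar>p\<bar>) * (Ce * real (Suc m) powr s))"
      proof -
        have "card {k. u * k \<le> m} \<le> Suc m" using card_mono[OF _ fin(2)[of m]] by simp
        then show ?thesis
          unfolding sum_constant using Cq Ce0 by (intro mult_right_mono) auto
      qed
      also have "\<dots> = Cq * Ce * (real (Suc m) powr 1 * real (Suc m) powr \<bar>p\<bar> * real (Suc m) powr s)"
        by simp
      also have "\<dots> = (Cq * Ce) * real (Suc m) powr (1 + \<bar>p\<bar> + s)"
        by (simp only: powr_add)
      finally have "g m \<le> (Cq * Ce) * real (Suc m) powr (1 + \<bar>p\<bar> + s)" .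
      moreover have "g m \<ge> 0" unfolding g_def by (intro sum_nonneg) auto
      ultimately show ?thesis by simp
    qed
    have summ: "summable (\<lambda>m. norm (of_real (g m) * F x m))"
      by (rule geometric_decay_summable[OF geometric_decay_mult[OF F_decay[OF x] g_bound]])
    have "eventually (\<lambda>(m, N). norm (h m N) \<le> norm (of_real (g m) * F x m)) (at_top \<times>\<^sub>F sequentially)"
      using h_bound by (intro always_eventually) auto
    from tannerys_theorem[OF h_limit this summ]
    have "(\<lambda>N. \<Sum>m. h m N) \<longlonglongrightarrow> (\<Sum>m. A m * C m * of_real x ^ m)"
      by simp
    then show ?thesis unfolding sums_def partial .
  qed
  \<comment> \<open>The majorant \<open>M\<close> does not depend on \<open>x\<close>, so the limit
    at 1 may be taken under the sum over \<open>k\<close>; it also yields absolute summability of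
    \<open>R\<close>.\<close>
  have "eventually (\<lambda>(k, x). norm (t k x) \<le> M k) (at_top \<times>\<^sub>F at_left 1)"
    unfolding eventually_prod_filter
    using at1 t_bound by (intro exI[of _ "\<lambda>_. True"] exI[of _ "\<lambda>x. x \<in> I"]) auto
  from tannerys_theorem[OF t_limit this M]
  have sR: "summable (\<lambda>k. norm (R k))" and lim: "((\<lambda>x. \<Sum>k. t k x) \<longlongrightarrow> suminf R) (at_left 1)"
    by simp_all
  have "((\<lambda>x::real. \<Sum>m. A m * C m * of_real x ^ m) \<longlongrightarrow> S) (at_left 1)"
    using S unfolding C_def e_def by (rule Abel_limit_theorem)
  moreover have "eventually (\<lambda>x. (\<Sum>m. A m * C m * of_real x ^ m) = (\<Sum>k. t k x)) (at_left 1)"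
    using at1 by eventually_elim (use t_sums in \<open>simp add: sums_iff\<close>)
  ultimately have "((\<lambda>x. \<Sum>k. t k x) \<longlongrightarrow> S) (at_left 1)"
    by (rule Lim_transform_eventually)
  with lim have "suminf R = S"
    by (intro tendsto_unique) auto
  then show ?thesis
    using summable_norm_cancel[OF sR] by (simp add: sums_iff)
qed

section \<open>Summation of the double series in both orders\<close>

theorem lemma1:
  fixes w u :: nat and v :: int
    and M D lam :: complex
    and alpha beta delta gamma a b :: "complex list"
  assumes "w \<ge> 1" and "u \<ge> 1" and "length a = length b"
    and "set beta \<inter> \<int>\<^sub>\<le>\<^sub>0 = {}" and "set gamma \<inter> \<int>\<^sub>\<le>\<^sub>0 = {}" and "set b \<inter> \<int>\<^sub>\<le>\<^sub>0 = {}"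
    and "\<forall>x\<in>{0<..<(1::real)}.
           hyp_defined alpha beta (M * of_real x ^ w) \<and>
           hyp_defined delta gamma (D * of_real x ^ u / of_real (1 - x) powi v) \<and>
           hyp_F alpha beta (M * of_real x ^ w) =
             of_real (1 - x) powr lam *
             hyp_F delta gamma (D * of_real x ^ u / of_real (1 - x) powi v)"
    and "(\<exists>n::nat. n \<ge> 1 \<and> - of_nat n \<in> set delta \<union> set a) \<or>
         (v = 0 \<and> D = 1 \<and> (\<forall>z\<in>set a. Re z > 0) \<and>
          Re (excess a b + lam) > 0 \<and>
          Re (excess a b + excess delta gamma + lam) > 0)"
    and "hyp_converges (alpha @ Delta a w) (beta @ Delta b w) M"
    and "\<forall>k. vpoch delta k * vpoch a (u * k) \<noteq> 0 \<longrightarrow>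
           hyp_converges ((- lam + of_int v * of_nat k) # vshift a (of_nat (u * k)))
             (vshift b (of_nat (u * k))) 1"
  shows "(\<lambda>k. vpoch delta k * vpoch a (u * k) * D ^ k /
              (vpoch gamma k * vpoch b (u * k) * fact k) *
              hyp_F ((- lam + of_int v * of_nat k) # vshift a (of_nat (u * k)))
                (vshift b (of_nat (u * k))) 1)
         sums hyp_F (alpha @ Delta a w) (beta @ Delta b w) M"
proof -
  note w = assms(1) and u = assms(2) and len = assms(3) and gamma = assms(5) and b = assms(6)
    and hyp = assms(7) and cases = assms(8) and lhs = assms(9) and rhs = assms(10)
  define A where "A = (\<lambda>m. vpoch a m / vpoch b m)"
  define q where "q = hyp_term delta gamma D"
  define e where "e = (\<lambda>k j. pochhammer (- lam + of_int v * of_nat k) j / fact j :: complex)"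
  define R where "R = (\<lambda>k. vpoch delta k * vpoch a (u * k) * D ^ k /
              (vpoch gamma k * vpoch b (u * k) * fact k) *
              hyp_F ((- lam + of_int v * of_nat k) # vshift a (of_nat (u * k)))
                (vshift b (of_nat (u * k))) 1)"
  define S where "S = hyp_F (alpha @ Delta a w) (beta @ Delta b w) M"
  \<comment> \<open>If the outer factor vanishes, convergence of the inner series is not assumed.
    Then every term on the left is 0: either \<open>q k\<close> vanishes, or \<open>A\<close>
    vanishes from index \<open>u * k\<close> on.\<close>
  have R: "(\<lambda>j. q k * (e k j * A (u * k + j))) sums R k" for k
  proof (cases "vpoch delta k * vpoch a (u * k) = 0")
    case True
    then have "q k * (e k j * A (u * k + j)) = 0" for j
      by (auto simp: q_def hyp_term_def A_def vpoch_add)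
    moreover have "R k = 0" using True by (auto simp: R_def)
    ultimately show ?thesis by (simp only: sums_zero)
  next
    case False
    define F where "F = hyp_term ((- lam + of_int v * of_nat k) # vshift a (of_nat (u * k))) (vshift b (of_nat (u * k))) 1"
    have "summable F"
      using rhs False by (auto simp: hyp_converges_def F_def)
    then have "(\<lambda>j. q k * A (u * k) * F j) sums (q k * A (u * k) * suminf F)"
      by (intro sums_mult summable_sums)
    moreover have "q k * A (u * k) * F j = q k * (e k j * A (u * k + j))" for j
      by (simp only: A_def e_def F_def mult.assoc hyp_term_vshift)
    moreover have "R k = q k * A (u * k) * suminf F"
    proof -
      have "hyp_F ((- lam + of_int v * of_nat k) # vshift a (of_nat (u * k))) (vshift b (of_nat (u * k))) 1 = suminf F"
        using \<open>summable F\<close> unfolding hyp_F_def hyp_converges_def F_def by (simp only: if_True)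
      moreover have "vpoch delta k * vpoch a (u * k) * D ^ k / (vpoch gamma k * vpoch b (u * k) * fact k) = q k * A (u * k)"
        by (simp add: q_def hyp_term_def A_def mult_ac)
      ultimately show ?thesis by (simp only: R_def)
    qed
    ultimately show ?thesis by (simp only:)
  qed
  have S: "(\<lambda>m. A m * (\<Sum>k | u * k \<le> m. q k * e k (m - u * k))) sums S"
  proof -
    define c where "c = (\<lambda>m. A m * (if w dvd m then hyp_term alpha beta M (m div w) else 0))"
    have "(\<lambda>n. hyp_term (alpha @ Delta a w) (beta @ Delta b w) M n) sums S"
      using lhs by (simp add: S_def hyp_F_def hyp_converges_def summable_sums)
    moreover have "hyp_term (alpha @ Delta a w) (beta @ Delta b w) M n = c (w * n)" for n
      using w by (simp add: hyp_term_Delta[OF w len] c_def A_def)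
    ultimately have "(\<lambda>n. c (w * n)) sums S" by simp
    \<comment> \<open>\<open>c\<close> vanishes off the multiples of \<open>w\<close>, so summing
      along \<open>w * n\<close> or along all indices is the same.\<close>
    then have "c sums S"
    proof (subst (asm) sums_mono_reindex)
      show "strict_mono (\<lambda>n. w * n)" using w by (intro strict_monoI) simp
      show "c m = 0" if "m \<notin> range (\<lambda>n. w * n)" for m
        using that by (auto simp: c_def elim!: dvdE)
    qed
    then show ?thesis
      unfolding q_def e_def coefficient_identity[OF w u hyp] c_def .
  qed
  have "R sums S"
    using cases
  proof
    assume "\<exists>n::nat. n \<ge> 1 \<and> - of_nat n \<in> set delta \<union> set a"
    then obtain n where n: "- of_nat n \<in> set delta \<or> - of_nat n \<in> set a" by auto
    have zero: "vpoch delta k = 0 \<or> vpoch a (u * k) = 0" if "k > n" for k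
    proof -
      have "k \<le> u * k" using u by simp
      then have "n < u * k" using that by linarith
      then show ?thesis using n that vpoch_eq_0 by blast
    qed
    have trunc: "A m * (\<Sum>k | u * k \<le> m. q k * e k (m - u * k)) =
        A m * (\<Sum>k | k < Suc n \<and> u * k \<le> m. q k * e k (m - u * k))" for m
    proof -
      \<comment> \<open>If it is \<open>vpoch a (u * k)\<close> that vanishes, then so does
        \<open>vpoch a m\<close> for the larger index \<open>m\<close>, and the factor
        \<open>A m\<close> kills the term.\<close>
      have vanish: "A m * (q k * e k (m - u * k)) = 0" if "k > n" "u * k \<le> m" for k
        using zero[OF that(1)] vpoch_eq_0_mono[OF _ that(2), of a]
        by (auto simp: A_def q_def hyp_term_def)
      show ?thesis
        unfolding sum_distrib_left
      proof (rule sum.mono_neutral_right)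
        show "\<forall>k\<in>{k. u * k \<le> m} - {k. k < Suc n \<and> u * k \<le> m}. A m * (q k * e k (m - u * k)) = 0"
        proof
          fix k assume "k \<in> {k. u * k \<le> m} - {k. k < Suc n \<and> u * k \<le> m}"
          then have "k > n" "u * k \<le> m" by auto
          then show "A m * (q k * e k (m - u * k)) = 0" by (rule vanish)
        qed
      qed (use finite_mult_le[OF u] in auto)
    qed
    have "(\<lambda>m. A m * (\<Sum>k | k < Suc n \<and> u * k \<le> m. q k * e k (m - u * k))) sums (\<Sum>k<Suc n. R k)"
      using R by (rule sums_regroup_finite)
    with S[unfolded trunc] have "S = (\<Sum>k<Suc n. R k)"
      by (rule sums_unique2)
    moreover have "R sums (\<Sum>k<Suc n. R k)"
    proof (rule sums_finite)
      show "R k = 0" if "k \<notin> {..<Suc n}" for k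
        using zero[of k] that by (auto simp: R_def)
    qed simp
    ultimately show ?thesis by (simp only:)
  next
    assume ii: "v = 0 \<and> D = 1 \<and> (\<forall>z\<in>set a. Re z > 0) \<and>
          Re (excess a b + lam) > 0 \<and>
          Re (excess a b + excess delta gamma + lam) > 0"
    then have v: "v = 0" and D: "D = 1" by auto
    have "hyp_defined delta gamma (1 * of_real (1 / 2) ^ u)"
      using bspec[OF hyp, of "1/2"] v D by simp
    then have "fps_conv_radius (Abs_fps (hyp_term delta gamma 1)) > 0"
      by (rule hyp_term_radius_pos) simp
    then obtain C where C: "\<And>k. norm (q k) \<le> C * real (Suc k) powr (Re (sum_list delta - sum_list gamma) - 1)"
      using hyp_term_bound[OF _ gamma] unfolding q_def D by blast
    show ?thesis
    proof (rule sums_regroup_symbol[OF u len b C refl _ _ A_def])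
      \<comment> \<open>These are the two inequalities on the excesses. In the second, the left
        \<open>- 1\<close> comes from the growth of \<open>q\<close>, the right one from summability
        over \<open>k\<close>.\<close>
      show "Re (sum_list a - sum_list b) - Re lam < 0"
        "Re (sum_list delta - sum_list gamma) - 1 + Re (sum_list a - sum_list b) - Re lam < - 1"
        using ii by (auto simp: excess_def)
      show "(\<lambda>j. q k * (pochhammer (- lam) j / fact j * A (u * k + j))) sums R k" for k
        using R[of k] by (simp add: e_def v)
      show "(\<lambda>m. A m * (\<Sum>k | u * k \<le> m. q k * (pochhammer (- lam) (m - u * k) / fact (m - u * k)))) sums S"
        using S by (simp add: e_def v)
    qed
  qed
  then show ?thesis unfolding R_def S_def .
qed

end
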